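(* Let $G,H:I\to\mathbb{R}$ be continuous functions such that for all $x\in I$: $G(x)\le H(x)$, $E_x[\sup_{t\ge0}|e^{-rt}G(X_t)|]<\infty$, $E_x[\sup_{t\ge0}|e^{-rt}H(X_t)|]<\infty$ and $P_x(\lim_{t\to\infty}e^{-rt}G(X_t)=\lim_{t\to\infty}e^{-rt}H(X_t))=1$. Let $$\hat V=\inf_{U\in\mathrm{Sup}[G,H)}U,\qquad \check V=\sup_{U\in\mathrm{Sub}(G,H]}U$$ (pointwise infimum and supremum). Then $$(G)_H^{**}=\hat V\qquad\text{and}\qquad (H)^G_{**}=\check V\qquad\text{on } I.$$
   Context: Setting. $I=(a,b)\subseteq\mathbb{R}$ is an open interval and $X$ is a regular one-dimensional diffusion with state space $I$, $X_0=x$ under $P_x$, with natural boundaries ($P_x(T_a<\infty)=P_x(T_b<\infty)=0$, $T_y=\inf\{t\ge0:X_t=y\}$), generator $\mathbb{L}_X$, and $r>0$ is fixed. $\varphi$ (increasing) and $\psi$ (decreasing) are the positive, continuous, strictly monotone solutions on $I$ of $\mathbb{L}_Xf=rf$ with $\varphi(a+)=\psi(b-)=0$, $\varphi(b-)=\psi(a+)=+\infty$; $E_x[e^{-rT_y}\mathbb{I}_{[T_y<\infty]}]=\psi(x)/\psi(y)$ for $x>y$ and $=\varphi(x)/\varphi(y)$ for $x\le y$. $F=\varphi/\psi:I\to(0,\infty)$ is a strictly increasing continuous bijection. Admissible sets. $\mathrm{Sup}[G,H)=\{U:I\to\mathbb{R}\mid G\le U\le H,\ U$ continuous and $r$-superharmonic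 on $\{U<H\}\}$, $\mathrm{Sub}(G,H]=\{U:I\to\mathbb{R}\mid G\le U\le H,\ U$ continuous and $r$-subharmonic on $\{U>G\}\}$. Here $U$ is $r$-superharmonic on an open set $A\subseteq I$ if $U/\psi$ is $F$-concave on every interval contained in $A$, i.e. $\frac{U}{\psi}(x)\ge\frac{U}{\psi}(y)\frac{F(z)-F(x)}{F(z)-F(y)}+\frac{U}{\psi}(z)\frac{F(x)-F(y)}{F(z)-F(y)}$ whenever $y\le x\le z$, $y<z$, $[y,z]\subseteq A$ (equivalently $U(x)\ge E_x[e^{-r(T_y\wedge T_z)}U(X_{T_y\wedge T_z})]$ for such $y,x,z$); $r$-subharmonic on $A$ is the same with the inequality reversed. Transformed functions. $W^G=(G/\psi)\circ F^{-1}$, $W_H=(H/\psi)\circ F^{-1}$ on $(0,\infty)$. For $f:(0,\infty)\to\mathbb{R}$, $x>0$, $c,p\in\mathbb{R}$: $l_f^x(c,p)=\sup\{z\le x: f(z)-p=c(z-x)\}$, $r_f^x(c,p)=\inf\{y\ge x: f(y)-p=c(y-x)\}$, with $\sup\emptyset=0$, $\inf\emptyset=+\infty$; write $l_G^x,r_G^x$ for $f=W^G$ and $l_H^x,r_H^x$ for $f=W_H$. Put $\widehat{\mathcal A}_G^x(c)=\bigcup_{p\in[W^G(x),W_H(x)]}\{y>0: l_H^x(c,p)\le l_G^x(c,p)\le y\le r_G^x(c,p)\le r_H^x(c,p)\}$, $\widehat{\mathcal A}^H_x(c)=\bigcup_{p\in[W^G(x),W_H(x)]}\{y>0: l_G^x(c,p)\le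 l_H^x(c,p)\le y\le r_H^x(c,p)\le r_G^x(c,p)\}$, $(W^G)_H^{**}(x)=\sup_{z\in\mathbb{R}}\sup_{y\in\widehat{\mathcal A}_G^x(z)}(z(x-y)+W^G(y))$, $(W_H)^G_{**}(x)=\inf_{z\in\mathbb{R}}\inf_{y\in\widehat{\mathcal A}^H_x(z)}(z(x-y)+W_H(y))$ for $x>0$, and for $x\in I$, $(G)_H^{**}(x)=(W^G)_H^{**}(F(x))\psi(x)$, $(H)^G_{**}(x)=(W_H)^G_{**}(F(x))\psi(x)$. *)

theory Defs
  imports "HOL-Probability.Probability"
begin

section \<open>Regular one-dimensional diffusions with natural boundaries\<close>

text \<open>
  Paths take values in the closure [a, b] of the state space (in the extended reals), so that the
  hitting times of the boundary points a and b are meaningful.  The infimum of the empty set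
  is infinity in \<^typ>\<open>ennreal\<close>.
\<close>

definition hitting_time :: "(real \<Rightarrow> 'w \<Rightarrow> ereal) \<Rightarrow> ereal \<Rightarrow> 'w \<Rightarrow> ennreal" where
  "hitting_time X y \<omega> = (INF t\<in>{t. 0 \<le> t \<and> X t \<omega> = y}. ennreal t)"

text \<open>
  A filtration indexed by \<^typ>\<open>ennreal\<close> has stopping times which may be infinite.  In the strong
  Markov property \<open>T\<close> is such a stopping time and \<open>A\<close> an event of the sigma-algebra at \<open>T\<close>;
  the identity is
  P_x(A, T < oo, X_{T+t} in B) = E_x[1_A 1_{T < oo} P_{X_T}(X_t in B)].
\<close>

locale regular_diffusion =
  filtration "space M" F
  for M :: "'w measure" and F :: "ennreal \<Rightarrow> 'w measure" +
  fixes a b :: ereal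
    and P :: "real \<Rightarrow> 'w measure"
    and X :: "real \<Rightarrow> 'w \<Rightarrow> ereal"
  assumes a_less_b: "a < b"
    and subalgebra_F: "\<And>t. subalgebra M (F t)"
    and prob_space_P: "\<And>x. x \<in> einterval a b \<Longrightarrow> prob_space (P x)"
    and sets_P: "\<And>x. x \<in> einterval a b \<Longrightarrow> sets (P x) = sets M"
    and adapted: "\<And>t. 0 \<le> t \<Longrightarrow> X t \<in> borel_measurable (F (ennreal t))"
    and path_range: "\<And>t \<omega>. 0 \<le> t \<Longrightarrow> \<omega> \<in> space M \<Longrightarrow> X t \<omega> \<in> {a..b}"
    and path_continuous: "\<And>\<omega>. \<omega> \<in> space M \<Longrightarrow> continuous_on {0..} (\<lambda>t. X t \<omega>)"
    and start: "\<And>x. x \<in> einterval a b \<Longrightarrow> AE \<omega> in P x. X 0 \<omega> = ereal x"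
    and kernel: "\<And>t B. 0 \<le> t \<Longrightarrow> B \<in> sets borel \<Longrightarrow>
      (\<lambda>y. emeasure (P y) {\<omega>\<in>space M. X t \<omega> \<in> B})
        \<in> borel_measurable (restrict_space borel (einterval a b))"
    and strong_markov: "\<And>x T A t B.
      x \<in> einterval a b \<Longrightarrow> stopping_time F T \<Longrightarrow> A \<in> sets (pre_sigma T) \<Longrightarrow>
      0 \<le> t \<Longrightarrow> B \<in> sets borel \<Longrightarrow>
      emeasure (P x) {\<omega>\<in>A. T \<omega> < \<infinity> \<and> X (enn2real (T \<omega>) + t) \<omega> \<in> B} =
      (\<integral>\<^sup>+\<omega>. indicator {\<omega>\<in>A. T \<omega> < \<infinity>} \<omega> *
         emeasure (P (real_of_ereal (X (enn2real (T \<omega>)) \<omega>))) {\<omega>'\<in>space M. X t \<omega>' \<in> B} \<partial>P x)"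
    and regular: "\<And>x y. x \<in> einterval a b \<Longrightarrow> y \<in> einterval a b \<Longrightarrow>
      0 < measure (P x) {\<omega>\<in>space M. hitting_time X (ereal y) \<omega> < \<infinity>}"
    and natural_left: "\<And>x. x \<in> einterval a b \<Longrightarrow>
      AE \<omega> in P x. \<not> hitting_time X a \<omega> < \<infinity>"
    and natural_right: "\<And>x. x \<in> einterval a b \<Longrightarrow>
      AE \<omega> in P x. \<not> hitting_time X b \<omega> < \<infinity>"

text \<open>
  The functions solving L_X f = r f are unbounded, so the generator is taken in the local form of
  Dynkin's characteristic operator: L_X f (x) is the limit of
  (E_x f(X_T) - f(x)) / E_x T, where T is the exit time of (y, z), as y tends to x from below
  and z tends to x from above.
\<close>

definition exit_time :: "(real \<Rightarrow> 'w \<Rightarrow> ereal) \<Rightarrow> real \<Rightarrow> real \<Rightarrow> 'w \<Rightarrow> ennreal" where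
  "exit_time X y z \<omega> = min (hitting_time X (ereal y) \<omega>) (hitting_time X (ereal z) \<omega>)"

definition has_generator_value ::
  "(real \<Rightarrow> 'w measure) \<Rightarrow> (real \<Rightarrow> 'w \<Rightarrow> ereal) \<Rightarrow> (real \<Rightarrow> real) \<Rightarrow> real \<Rightarrow> real \<Rightarrow> bool" where
  "has_generator_value P X f x l \<longleftrightarrow>
     ((\<lambda>(y, z). ((\<integral>\<omega>. f (real_of_ereal (X (enn2real (exit_time X y z \<omega>)) \<omega>)) \<partial>P x) - f x)
                / enn2real (\<integral>\<^sup>+\<omega>. exit_time X y z \<omega> \<partial>P x)) \<longlongrightarrow> l)
       (at_left x \<times>\<^sub>F at_right x)"

definition discount_at :: "real \<Rightarrow> ennreal \<Rightarrow> real" where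
  "discount_at r T = (if T = \<infinity> then 0 else exp (- r * enn2real T))"

locale discounted_diffusion =
  regular_diffusion M F a b P X
  for M :: "'w measure" and F a b P X +
  fixes r :: real
    and \<phi> \<psi> :: "real \<Rightarrow> real"
  assumes r_pos: "0 < r"
    and phi_pos: "\<And>x. x \<in> einterval a b \<Longrightarrow> 0 < \<phi> x"
    and psi_pos: "\<And>x. x \<in> einterval a b \<Longrightarrow> 0 < \<psi> x"
    and phi_continuous: "continuous_on (einterval a b) \<phi>"
    and psi_continuous: "continuous_on (einterval a b) \<psi>"
    and phi_increasing: "strict_mono_on (einterval a b) \<phi>"
    and psi_decreasing: "strict_antimono_on (einterval a b) \<psi>"
    and phi_generator: "\<And>x. x \<in> einterval a b \<Longrightarrow> has_generator_value P X \<phi> x (r * \<phi> x)"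
    and psi_generator: "\<And>x. x \<in> einterval a b \<Longrightarrow> has_generator_value P X \<psi> x (r * \<psi> x)"
    and phi_left: "((\<phi> \<circ> real_of_ereal) \<longlongrightarrow> 0) (at_right a)"
    and psi_right: "((\<psi> \<circ> real_of_ereal) \<longlongrightarrow> 0) (at_left b)"
    and phi_right: "filterlim (\<phi> \<circ> real_of_ereal) at_top (at_left b)"
    and psi_left: "filterlim (\<psi> \<circ> real_of_ereal) at_top (at_right a)"
    and hit_below: "\<And>x y. x \<in> einterval a b \<Longrightarrow> y \<in> einterval a b \<Longrightarrow> y < x \<Longrightarrow>
      (\<integral>\<omega>. discount_at r (hitting_time X (ereal y) \<omega>) \<partial>P x) = \<psi> x / \<psi> y"
    and hit_above: "\<And>x y. x \<in> einterval a b \<Longrightarrow> y \<in> einterval a b \<Longrightarrow> x \<le> y \<Longrightarrow>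
      (\<integral>\<omega>. discount_at r (hitting_time X (ereal y) \<omega>) \<partial>P x) = \<phi> x / \<phi> y"


section \<open>Superharmonic and subharmonic functions; admissible sets\<close>

definition scale_quot :: "(real \<Rightarrow> real) \<Rightarrow> (real \<Rightarrow> real) \<Rightarrow> real \<Rightarrow> real" where
  "scale_quot \<phi> \<psi> x = \<phi> x / \<psi> x"

definition r_superharmonic_on ::
  "(real \<Rightarrow> real) \<Rightarrow> (real \<Rightarrow> real) \<Rightarrow> real set \<Rightarrow> (real \<Rightarrow> real) \<Rightarrow> bool" where
  "r_superharmonic_on \<phi> \<psi> A U \<longleftrightarrow>
     (\<forall>x y z. y \<le> x \<and> x \<le> z \<and> y < z \<and> {y..z} \<subseteq> A \<longrightarrow>
        (let F = scale_quot \<phi> \<psi> in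
         U x / \<psi> x \<ge> U y / \<psi> y * ((F z - F x) / (F z - F y)) + U z / \<psi> z * ((F x - F y) / (F z - F y))))"

definition r_subharmonic_on ::
  "(real \<Rightarrow> real) \<Rightarrow> (real \<Rightarrow> real) \<Rightarrow> real set \<Rightarrow> (real \<Rightarrow> real) \<Rightarrow> bool" where
  "r_subharmonic_on \<phi> \<psi> A U \<longleftrightarrow>
     (\<forall>x y z. y \<le> x \<and> x \<le> z \<and> y < z \<and> {y..z} \<subseteq> A \<longrightarrow>
        (let F = scale_quot \<phi> \<psi> in
         U x / \<psi> x \<le> U y / \<psi> y * ((F z - F x) / (F z - F y)) + U z / \<psi> z * ((F x - F y) / (F z - F y))))"

definition superharmonic_class ::
  "real set \<Rightarrow> (real \<Rightarrow> real) \<Rightarrow> (real \<Rightarrow> real) \<Rightarrow> (real \<Rightarrow> real) \<Rightarrow> (real \<Rightarrow> real) \<Rightarrow> (real \<Rightarrow> real) set" where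
  "superharmonic_class I \<phi> \<psi> G H =
     {U. (\<forall>x\<in>I. G x \<le> U x \<and> U x \<le> H x) \<and> continuous_on I U \<and>
         r_superharmonic_on \<phi> \<psi> {x\<in>I. U x < H x} U}"

definition subharmonic_class ::
  "real set \<Rightarrow> (real \<Rightarrow> real) \<Rightarrow> (real \<Rightarrow> real) \<Rightarrow> (real \<Rightarrow> real) \<Rightarrow> (real \<Rightarrow> real) \<Rightarrow> (real \<Rightarrow> real) set" where
  "subharmonic_class I \<phi> \<psi> G H =
     {U. (\<forall>x\<in>I. G x \<le> U x \<and> U x \<le> H x) \<and> continuous_on I U \<and>
         r_subharmonic_on \<phi> \<psi> {x\<in>I. G x < U x} U}"


section \<open>Transformed functions and constrained biconjugates\<close>

definition transformed ::
  "real set \<Rightarrow> (real \<Rightarrow> real) \<Rightarrow> (real \<Rightarrow> real) \<Rightarrow> (real \<Rightarrow> real) \<Rightarrow> real \<Rightarrow> real" where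
  "transformed I \<phi> \<psi> G = (\<lambda>x. G x / \<psi> x) \<circ> the_inv_into I (scale_quot \<phi> \<psi>)"

text \<open>
  In the next two definitions \<open>f\<close> is regarded as a function on the positive reals; the conventions
  sup {} = 0 and inf {} = infinity are in force.
\<close>

definition left_touch :: "(real \<Rightarrow> real) \<Rightarrow> real \<Rightarrow> real \<Rightarrow> real \<Rightarrow> real" where
  "left_touch f x c p =
     (let S = {z. 0 < z \<and> z \<le> x \<and> f z - p = c * (z - x)} in if S = {} then 0 else Sup S)"

definition right_touch :: "(real \<Rightarrow> real) \<Rightarrow> real \<Rightarrow> real \<Rightarrow> real \<Rightarrow> ereal" where
  "right_touch f x c p = (INF y\<in>{y. x \<le> y \<and> f y - p = c * (y - x)}. ereal y)"

definition lower_admissible ::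
  "(real \<Rightarrow> real) \<Rightarrow> (real \<Rightarrow> real) \<Rightarrow> real \<Rightarrow> real \<Rightarrow> real set" where
  "lower_admissible WG WH x c =
     (\<Union>p\<in>{WG x..WH x}. {y. 0 < y \<and>
        left_touch WH x c p \<le> left_touch WG x c p \<and> left_touch WG x c p \<le> y \<and>
        ereal y \<le> right_touch WG x c p \<and> right_touch WG x c p \<le> right_touch WH x c p})"

definition upper_admissible ::
  "(real \<Rightarrow> real) \<Rightarrow> (real \<Rightarrow> real) \<Rightarrow> real \<Rightarrow> real \<Rightarrow> real set" where
  "upper_admissible WG WH x c =
     (\<Union>p\<in>{WG x..WH x}. {y. 0 < y \<and>
        left_touch WG x c p \<le> left_touch WH x c p \<and> left_touch WH x c p \<le> y \<and>
        ereal y \<le> right_touch WH x c p \<and> right_touch WH x c p \<le> right_touch WG x c p})"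

text \<open>
  Suprema and infima are taken in the extended reals: some of the admissible sets may be empty.
\<close>

definition biconj_lower :: "(real \<Rightarrow> real) \<Rightarrow> (real \<Rightarrow> real) \<Rightarrow> real \<Rightarrow> ereal" where
  "biconj_lower WG WH x =
     (SUP z\<in>(UNIV::real set). SUP y\<in>lower_admissible WG WH x z. ereal (z * (x - y) + WG y))"

definition biconj_upper :: "(real \<Rightarrow> real) \<Rightarrow> (real \<Rightarrow> real) \<Rightarrow> real \<Rightarrow> ereal" where
  "biconj_upper WG WH x =
     (INF z\<in>(UNIV::real set). INF y\<in>upper_admissible WG WH x z. ereal (z * (x - y) + WH y))"

definition biconj_lower_diffusion ::
  "real set \<Rightarrow> (real \<Rightarrow> real) \<Rightarrow> (real \<Rightarrow> real) \<Rightarrow> (real \<Rightarrow> real) \<Rightarrow> (real \<Rightarrow> real) \<Rightarrow> real \<Rightarrow> ereal" where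
  "biconj_lower_diffusion I \<phi> \<psi> G H x =
     biconj_lower (transformed I \<phi> \<psi> G) (transformed I \<phi> \<psi> H) (scale_quot \<phi> \<psi> x) * ereal (\<psi> x)"

definition biconj_upper_diffusion ::
  "real set \<Rightarrow> (real \<Rightarrow> real) \<Rightarrow> (real \<Rightarrow> real) \<Rightarrow> (real \<Rightarrow> real) \<Rightarrow> (real \<Rightarrow> real) \<Rightarrow> real \<Rightarrow> ereal" where
  "biconj_upper_diffusion I \<phi> \<psi> G H x =
     biconj_upper (transformed I \<phi> \<psi> G) (transformed I \<phi> \<psi> H) (scale_quot \<phi> \<psi> x) * ereal (\<psi> x)"

end

theory Submission
  imports Defs
begin

text \<open>
  In the scale \<open>F = \<phi> / \<psi>\<close> the problem becomes one about a tube \<open>g \<le> h\<close> over the positive half-line, with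
  \<open>g = W^G\<close> and \<open>h = W_H\<close>.  Let \<open>V x\<close> be the largest height at \<open>x\<close> of a segment that lies below \<open>h\<close> and
  has both ends below \<open>g\<close>.  Elementary planar arguments show that \<open>V\<close> is continuous, and concave
  wherever \<open>V < h\<close>, so that \<open>V\<close> is admissible for the infimum.  Lowering such a segment slightly makes
  it meet \<open>g\<close> strictly before \<open>h\<close> on both sides, so \<open>V\<close> is below the constrained biconjugate.  Finally, a
  line that meets \<open>g\<close> before \<open>h\<close> on both sides cannot pass above an admissible \<open>u\<close>, since \<open>u\<close> is
  concave as long as it is below the line.  If the line never meets \<open>g\<close> on one side, this comparison
  needs \<open>h - g \<rightarrow> 0\<close> at 0 and \<open>(h - g) / t \<rightarrow> 0\<close> at infinity.  Both hold by dominated convergence: if \<open>y\<close> tends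
  to a boundary point, which is never reached, then the hitting time \<open>T_y\<close> tends to infinity, and so
  \<open>E[exp (- r T_y) (H - G) (y)]\<close> tends to 0.  The statement for the supremum is the one for the infimum
  applied to \<open>- H \<le> - G\<close>.
\<close>

section \<open>Chords in a tube\<close>

text \<open>The difference of the two lines is affine, so on [a, b] it is largest at an end; the
  sign of \<open>c - d\<close> tells at which one.\<close>

lemma line_le_line:
  fixes a b t p q c d x s :: real
  assumes "a \<le> t" "t \<le> b"
    and "p + c * (a - x) \<le> q + d * (a - s)" "p + c * (b - x) \<le> q + d * (b - s)"
  shows "p + c * (t - x) \<le> q + d * (t - s)"
proof (cases "c \<le> d")
  case True
  then have "(c - d) * t \<le> (c - d) * a" using assms by (intro mult_left_mono_neg) auto
  then show ?thesis using assms(3) by (simp add: algebra_simps)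
next
  case False
  then have "(c - d) * t \<le> (c - d) * b" using assms by (intro mult_left_mono) auto
  then show ?thesis using assms(4) by (simp add: algebra_simps)
qed

text \<open>The ends need only lie below \<open>g\<close>, so lowering a segment keeps it valid. The
  degenerate case \<open>y = x = z\<close> is allowed, which makes \<open>g x\<close> itself a
  height as soon as it is below \<open>h x\<close>. The domain is a parameter so that the tube can
  be reflected in the origin.\<close>

definition under_chord :: "real set \<Rightarrow> (real \<Rightarrow> real) \<Rightarrow> (real \<Rightarrow> real) \<Rightarrow> real \<Rightarrow> real \<Rightarrow> bool" where
  "under_chord D g h x p \<longleftrightarrow> (\<exists>y\<in>D. \<exists>z\<in>D. \<exists>c. y \<le> x \<and> x \<le> z \<and>
     p + c * (y - x) \<le> g y \<and> p + c * (z - x) \<le> g z \<and> (\<forall>t\<in>{y..z}. p + c * (t - x) \<le> h t))"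

definition chord_envelope :: "real set \<Rightarrow> (real \<Rightarrow> real) \<Rightarrow> (real \<Rightarrow> real) \<Rightarrow> real \<Rightarrow> real" where
  "chord_envelope D g h x = Sup {p. under_chord D g h x p}"

lemma under_chordI:
  assumes "y \<in> D" "z \<in> D" "y \<le> x" "x \<le> z"
    and "p + c * (y - x) \<le> g y" "p + c * (z - x) \<le> g z"
    and "\<And>t. y \<le> t \<Longrightarrow> t \<le> z \<Longrightarrow> p + c * (t - x) \<le> h t"
  shows "under_chord D g h x p"
  unfolding under_chord_def using assms by (meson atLeastAtMost_iff)

lemma under_chordE:
  assumes "under_chord D g h x p"
  obtains y z c where "y \<in> D" "z \<in> D" "y \<le> x" "x \<le> z"
    "p + c * (y - x) \<le> g y" "p + c * (z - x) \<le> g z"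
    "\<And>t. y \<le> t \<Longrightarrow> t \<le> z \<Longrightarrow> p + c * (t - x) \<le> h t"
proof -
  from assms obtain y z c where "y \<in> D" "z \<in> D" "y \<le> x" "x \<le> z"
    "p + c * (y - x) \<le> g y" "p + c * (z - x) \<le> g z" "\<forall>t\<in>{y..z}. p + c * (t - x) \<le> h t"
    unfolding under_chord_def by blast
  then show thesis by (intro that[of y z c]) auto
qed

text \<open>One and the same segment serves at every abscissa of its span.\<close>

lemma under_chord_move:
  assumes "y \<in> D" "z \<in> D" "y \<le> s" "s \<le> z"
    and "p + c * (y - x) \<le> g y" "p + c * (z - x) \<le> g z"
    and "\<And>t. y \<le> t \<Longrightarrow> t \<le> z \<Longrightarrow> p + c * (t - x) \<le> h t"
  shows "under_chord D g h s (p + c * (s - x))"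
proof -
  have *: "p + c * (s - x) + c * (t - s) = p + c * (t - x)" for t
    by (simp add: algebra_simps)
  show ?thesis by (rule under_chordI[of y D z _ _ c]) (use assms in \<open>simp_all add: *\<close>)
qed

lemma under_chord_le: "under_chord D g h x p \<Longrightarrow> p \<le> h x"
  by (erule under_chordE) (metis add.right_neutral diff_self mult_zero_right)

text \<open>Mirror symmetry, from which the right-hand versions of one-sided lemmas are
  obtained.\<close>

lemma under_chord_reflect:
  "under_chord (uminus ` D) (\<lambda>t. g (- t)) (\<lambda>t. h (- t)) (- x) p \<longleftrightarrow> under_chord D g h x p"
proof -
  \<comment> \<open>Stated for arbitrary data: reflection is an involution, so the converse is this
    implication for the reflected tube.\<close>
  have imp: "under_chord (uminus ` D) (\<lambda>t. g (- t)) (\<lambda>t. h (- t)) (- x) p"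
    if "under_chord D g h x p" for D :: "real set" and g h x p
    using that
  proof (rule under_chordE)
    fix y z c
    assume *: "y \<in> D" "z \<in> D" "y \<le> x" "x \<le> z"
      "p + c * (y - x) \<le> g y" "p + c * (z - x) \<le> g z"
      "\<And>t. y \<le> t \<Longrightarrow> t \<le> z \<Longrightarrow> p + c * (t - x) \<le> h t"
    have "p + - c * (t - - x) \<le> h (- t)" if "- z \<le> t" "t \<le> - y" for t
      using *(7)[of "- t"] that by (simp add: algebra_simps)
    then show ?thesis
      by (intro under_chordI[of "- z" _ "- y" _ _ "- c"]) (use * in \<open>auto simp: algebra_simps\<close>)
  qed
  show ?thesis
    using imp[of D g h x p] imp[of "uminus ` D" "\<lambda>t. g (- t)" "\<lambda>t. h (- t)" "- x" p]
    by (auto simp: image_image)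
qed

text \<open>Compare the line through (x, q) with the chord through (s, p), which lies above it at s.
  If the line is also below the chord at the left end of the chord, it can be followed to that end.
  Otherwise the chord is the steeper one and stays above the line to the right of s. It cannot reach
  x, where no chord attains height q, so its right end z lies before x, and there the line is below
  \<open>g\<close>.\<close>

lemma under_chord_extend_left:
  assumes "under_chord D g h s p" and "q + d * (s - x) < p" and "s \<le> x"
    and below: "\<And>t. s \<le> t \<Longrightarrow> t \<le> x \<Longrightarrow> q + d * (t - x) \<le> h t"
    and max: "\<And>p'. under_chord D g h x p' \<Longrightarrow> p' < q"
  obtains y where "y \<in> D" "y \<le> x" "q + d * (y - x) \<le> g y"
    "\<And>t. y \<le> t \<Longrightarrow> t \<le> x \<Longrightarrow> q + d * (t - x) \<le> h t"
  using assms(1)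
proof (rule under_chordE)
  fix y z c
  assume *: "y \<in> D" "z \<in> D" "y \<le> s" "s \<le> z"
    "p + c * (y - s) \<le> g y" "p + c * (z - s) \<le> g z"
    "\<And>t. y \<le> t \<Longrightarrow> t \<le> z \<Longrightarrow> p + c * (t - s) \<le> h t"
  show thesis
  proof (cases "q + d * (y - x) \<le> p + c * (y - s)")
    case True
    show thesis
    proof (rule that[of y])
      fix t assume t: "y \<le> t" "t \<le> x"
      show "q + d * (t - x) \<le> h t"
      proof (cases "t \<le> s")
        case True
        have "q + d * (t - x) \<le> p + c * (t - s)"
          using t(1) True \<open>q + d * (y - x) \<le> p + c * (y - s)\<close> assms(2)
          by (intro line_le_line[of y t s]) auto
        then show ?thesis using *(4) *(7)[of t] t True by linarith
      qed (use below t in auto)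
    qed (use * assms True in auto)
  next
    case False
    have "(c - d) * (s - y) > 0" using False assms(2) by (simp add: algebra_simps)
    then have "c > d" using *(3) by (simp add: zero_less_mult_iff)
    then have above: "q + d * (t - x) < p + c * (t - s)" if "s \<le> t" for t
      using mult_left_mono[of s t "c - d"] that assms(2) by (simp add: algebra_simps)
    have "z < x"
    proof (rule ccontr)
      assume "\<not> z < x"
      then have "under_chord D g h x (p + c * (x - s))"
        using assms(3) * by (intro under_chord_move[of y D z]) auto
      then show False using max[of "p + c * (x - s)"] above[of x] assms(3) by simp
    qed
    then show thesis
      using above[of z] * below by (intro that[of z]) auto
  qed
qed

lemma under_chord_extend_right:
  assumes "under_chord D g h s p" and "q + d * (s - x) < p" and "x \<le> s"
    and below: "\<And>t. x \<le> t \<Longrightarrow> t \<le> s \<Longrightarrow> q + d * (t - x) \<le> h t"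
    and max: "\<And>p'. under_chord D g h x p' \<Longrightarrow> p' < q"
  obtains z where "z \<in> D" "x \<le> z" "q + d * (z - x) \<le> g z"
    "\<And>t. x \<le> t \<Longrightarrow> t \<le> z \<Longrightarrow> q + d * (t - x) \<le> h t"
proof -
  show thesis
  proof (rule under_chord_extend_left[of "uminus ` D" "\<lambda>t. g (- t)" "\<lambda>t. h (- t)" "- s" p q "- d" "- x"])
    show "under_chord (uminus ` D) (\<lambda>t. g (- t)) (\<lambda>t. h (- t)) (- s) p"
      using assms(1) by (simp add: under_chord_reflect)
    show "q + - d * (t - - x) \<le> h (- t)" if "- s \<le> t" "t \<le> - x" for t
      using below[of "- t"] that by (simp add: algebra_simps)
    show "p' < q" if "under_chord (uminus ` D) (\<lambda>t. g (- t)) (\<lambda>t. h (- t)) (- x) p'" for p'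
      using max that by (simp add: under_chord_reflect)
    fix y
    assume y: "y \<in> uminus ` D" "y \<le> - x" "q + - d * (y - - x) \<le> g (- y)"
      "\<And>t. y \<le> t \<Longrightarrow> t \<le> - x \<Longrightarrow> q + - d * (t - - x) \<le> h (- t)"
    have "q + d * (t - x) \<le> h t" if "x \<le> t" "t \<le> - y" for t
      using y(4)[of "- t"] that by (simp add: algebra_simps)
    with y(1-3) show thesis by (intro that[of "- y"]) (auto simp: algebra_simps)
  qed (use assms in \<open>auto simp: algebra_simps\<close>)
qed

text \<open>A segment higher than \<open>A + \<eta>\<close> at x must come down to
  \<open>A + \<eta> / 2\<close> no later than x0, hence within a distance below \<delta>. It is
  therefore steep, and followed to the left it either breaks through \<open>h\<close> or ends where
  \<open>g\<close> is too low.\<close>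

lemma under_chord_usc_left:
  assumes "open D" "x0 \<in> D" "continuous_on D g" "continuous_on D h"
    and bound: "\<And>p. under_chord D g h x0 p \<Longrightarrow> p \<le> A"
    and A: "g x0 \<le> A" and "0 < \<eta>"
  obtains \<delta> where "0 < \<delta>" "\<And>x p. x0 - \<delta> < x \<Longrightarrow> x \<le> x0 \<Longrightarrow> under_chord D g h x p \<Longrightarrow> p \<le> A + \<eta>"
proof -
  have "isCont g x0" "isCont h x0"
    using assms by (auto simp: continuous_on_eq_continuous_at)
  then have "\<forall>\<^sub>F t in at x0. g t < A + \<eta> / 2" "\<forall>\<^sub>F t in at x0. h t < h x0 + 1"
    using A \<open>0 < \<eta>\<close> by (auto simp: isCont_def intro: order_tendstoD)
  then have "\<forall>\<^sub>F t in at x0. g t < A + \<eta> / 2 \<and> h t < h x0 + 1"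
    by eventually_elim auto
  then obtain \<rho> where \<rho>: "0 < \<rho>"
    "\<And>t. t \<noteq> x0 \<Longrightarrow> dist t x0 < \<rho> \<Longrightarrow> g t < A + \<eta> / 2 \<and> h t < h x0 + 1"
    by (auto simp: eventually_at)
  have near: "g t < A + \<eta> / 2" "h t < h x0 + 1" if "\<bar>t - x0\<bar> < \<rho>" for t
    using \<rho>(2)[of t] that A \<open>0 < \<eta>\<close> by (cases "t = x0"; simp add: dist_real_def)+
  \<comment> \<open>At the test point \<open>u\<close> the upper obstacle is at most
    \<open>A + M\<close>. The bound \<open>\<rho> / 4\<close> keeps x at least that far from
    \<open>u\<close>, and the other bound makes a slope beyond
    \<open>\<eta> / (2 * \<delta>)\<close> gain more than \<open>M\<close> over the length
    \<open>\<rho> / 4\<close>. Adding 1 to \<open>M\<close> avoids a division by zero.\<close>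
  define u where "u = x0 - \<rho> / 2"
  define M where "M = max 0 (h x0 + 1 - A)"
  define \<delta> where "\<delta> = min (\<rho> / 4) (\<rho> * \<eta> / (8 * (M + 1)))"
  have "0 \<le> M" by (simp add: M_def)
  have "0 < \<delta>"
    using \<open>0 < \<rho>\<close> \<open>0 < \<eta>\<close> \<open>0 \<le> M\<close> by (simp add: \<delta>_def)
  moreover have "\<delta> \<le> \<rho> / 4" "\<delta> \<le> \<rho> * \<eta> / (8 * (M + 1))"
    unfolding \<delta>_def by (rule min.cobounded1, rule min.cobounded2)
  ultimately have \<delta>: "0 < \<delta>" "\<delta> \<le> \<rho> / 4" "\<delta> \<le> \<rho> * \<eta> / (8 * (M + 1))" .
  have \<delta>M: "\<delta> * M \<le> \<rho> * \<eta> / 8"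
  proof -
    have "\<delta> * M \<le> \<delta> * (M + 1)" using \<delta> by (intro mult_left_mono) auto
    also have "\<dots> \<le> \<rho> * \<eta> / 8" using \<delta>(3) \<open>0 \<le> M\<close> by (simp add: field_simps)
    finally show ?thesis .
  qed
  have "p \<le> A + \<eta>" if x: "x0 - \<delta> < x" "x \<le> x0" and "under_chord D g h x p" for x p
    using that(3)
  proof (rule under_chordE)
    fix y z c
    assume *: "y \<in> D" "z \<in> D" "y \<le> x" "x \<le> z"
      "p + c * (y - x) \<le> g y" "p + c * (z - x) \<le> g z"
      "\<And>t. y \<le> t \<Longrightarrow> t \<le> z \<Longrightarrow> p + c * (t - x) \<le> h t"
    show "p \<le> A + \<eta>"
    proof (rule ccontr)
      assume p: "\<not> p \<le> A + \<eta>"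
      \<comment> \<open>The segment is low at \<open>q\<close> in both cases: if it ends there, it
        is below \<open>g\<close> near x0; if it passes over x0, its height there is bounded by
        A.\<close>
      define q where "q = min z x0"
      have q: "x \<le> q" "q \<le> x0" using * x by (auto simp: q_def)
      have Lq: "p + c * (q - x) \<le> A + \<eta> / 2"
      proof (cases "z \<le> x0")
        case True
        then have "p + c * (q - x) \<le> g z" using * by (simp add: q_def)
        also have "\<dots> \<le> A + \<eta> / 2" using near(1)[of z] * True x \<delta> \<open>0 < \<rho>\<close> by simp
        finally show ?thesis .
      next
        case False
        then have "under_chord D g h x0 (p + c * (x0 - x))"
          using * x by (intro under_chord_move[of y D z]) auto
        then show ?thesis using bound \<open>0 < \<eta>\<close> False by (fastforce simp: q_def min_def)
      qed
      have slope: "- c * (q - x) > \<eta> / 2" using Lq p by simp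
      then have "x < q" using q \<open>0 < \<eta>\<close> by (cases "x = q") auto
      then have "c < 0" using slope \<open>0 < \<eta>\<close>
        by (smt (verit) mult_nonneg_nonneg mult_minus_left half_gt_zero)
      have "- c * \<delta> > \<eta> / 2"
      proof -
        have "- c * (q - x) \<le> - c * \<delta>" using \<open>c < 0\<close> q x by (intro mult_left_mono) auto
        then show ?thesis using slope by simp
      qed
      \<comment> \<open>Towards the left the segment rises steeply. Either it reaches
        \<open>u\<close> and exceeds \<open>h\<close> there, or its left end lies within \<rho> of
        x0, where \<open>g\<close> is below \<open>A + \<eta> / 2\<close>.\<close>
      show False
      proof (cases "y \<le> u")
        case True
        then have "p + c * (u - x) \<le> h u"
          using * x \<delta> \<open>0 < \<rho>\<close> by (intro *(7)) (auto simp: u_def)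
        also have "h u \<le> A + M" using near(2)[of u] \<open>0 < \<rho>\<close> by (simp add: u_def M_def)
        finally have "- c * (x - u) \<le> M" using p \<open>0 < \<eta>\<close> by (simp add: algebra_simps)
        moreover have "- c * (\<rho> / 4) \<le> - c * (x - u)"
          using \<open>c < 0\<close> x \<delta> by (intro mult_left_mono) (auto simp: u_def)
        ultimately have "- c * (\<rho> / 4) \<le> M" by simp
        then have "- c * (\<rho> / 4) * \<delta> \<le> M * \<delta>" using \<delta> by (intro mult_right_mono) auto
        also have "\<dots> \<le> \<rho> * \<eta> / 8" using \<delta>M by (simp add: mult.commute)
        finally have "\<rho> / 4 * (- c * \<delta>) \<le> \<rho> / 4 * (\<eta> / 2)" by (simp add: algebra_simps)
        then show False
          using mult_strict_left_mono[OF \<open>- c * \<delta> > \<eta> / 2\<close>, of "\<rho> / 4"] \<open>0 < \<rho>\<close> by linarith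
      next
        case False
        then have "g y < A + \<eta> / 2" using * x \<open>0 < \<rho>\<close> by (intro near) (auto simp: u_def)
        moreover have "c * (y - x) \<ge> 0" using \<open>c < 0\<close> * by (intro mult_nonpos_nonpos) auto
        ultimately show False using * p \<open>0 < \<eta>\<close> by linarith
      qed
    qed
  qed
  then show thesis using that \<delta>(1) by blast
qed

text \<open>The points to the right of x0 are handled by the one-sided result for the reflected
  tube.\<close>

lemma under_chord_usc:
  assumes "open D" "x0 \<in> D" "continuous_on D g" "continuous_on D h"
    and "\<And>p. under_chord D g h x0 p \<Longrightarrow> p \<le> A"
    and "g x0 \<le> A" and "0 < \<eta>"
  obtains \<delta> where "0 < \<delta>" "\<And>x p. \<bar>x - x0\<bar> < \<delta> \<Longrightarrow> under_chord D g h x p \<Longrightarrow> p \<le> A + \<eta>"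
proof -
  obtain \<delta> where \<delta>: "0 < \<delta>" "\<And>x p. x0 - \<delta> < x \<Longrightarrow> x \<le> x0 \<Longrightarrow> under_chord D g h x p \<Longrightarrow> p \<le> A + \<eta>"
    using under_chord_usc_left[OF assms] by blast
  let ?D = "uminus ` D" and ?g = "\<lambda>t. g (- t)" and ?h = "\<lambda>t. h (- t)"
  have cont: "continuous_on ?D ?g" "continuous_on ?D ?h"
    using assms(3,4) by (auto intro!: continuous_on_compose2[of D _ ?D uminus] continuous_intros)
  have D: "open ?D" "- x0 \<in> ?D"
    using assms(1,2) by (auto simp: open_negations)
  have bd: "p \<le> A" if "under_chord ?D ?g ?h (- x0) p" for p
    using that assms(5) by (simp add: under_chord_reflect)
  obtain \<delta>' where \<delta>': "0 < \<delta>'" "\<And>x p. - x0 - \<delta>' < x \<Longrightarrow> x \<le> - x0 \<Longrightarrow> under_chord ?D ?g ?h x p \<Longrightarrow> p \<le> A + \<eta>"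
    by (rule under_chord_usc_left[OF D cont bd]) (use assms(6,7) in auto)
  show thesis
  proof (rule that[of "min \<delta> \<delta>'"])
    fix x p assume "\<bar>x - x0\<bar> < min \<delta> \<delta>'" "under_chord D g h x p"
    then show "p \<le> A + \<eta>"
      using \<delta>(2)[of x p] \<delta>'(2)[of "- x" p] by (cases "x \<le> x0") (auto simp: under_chord_reflect)
  qed (use \<delta> \<delta>' in auto)
qed

section \<open>The chord envelope of a tube: bounds, continuity and concavity\<close>

context
  fixes D :: "real set" and g h :: "real \<Rightarrow> real"
  assumes D: "open D"
    and cont: "continuous_on D g" "continuous_on D h"
    and le: "\<And>x. x \<in> D \<Longrightarrow> g x \<le> h x"
begin

lemma under_chord_self: "x \<in> D \<Longrightarrow> under_chord D g h x (g x)"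
  by (rule under_chordI[of x D x _ _ 0]) (auto dest: le)

lemma under_chord_le_envelope: "under_chord D g h x p \<Longrightarrow> p \<le> chord_envelope D g h x"
  unfolding chord_envelope_def
  by (rule cSup_upper) (auto simp: bdd_above_def dest: under_chord_le)

lemma chord_envelope_le:
  "x \<in> D \<Longrightarrow> (\<And>p. under_chord D g h x p \<Longrightarrow> p \<le> b) \<Longrightarrow> chord_envelope D g h x \<le> b"
  unfolding chord_envelope_def using under_chord_self[of x] by (intro cSup_least) auto

lemma chord_envelope_between:
  assumes "x \<in> D" shows "g x \<le> chord_envelope D g h x" "chord_envelope D g h x \<le> h x"
  using assms by (auto intro: under_chord_le_envelope under_chord_self chord_envelope_le under_chord_le)

lemma less_chord_envelopeD:
  assumes "x \<in> D" "q < chord_envelope D g h x"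
  obtains p where "under_chord D g h x p" "q < p"
proof -
  have "\<exists>p\<in>{p. under_chord D g h x p}. q < p"
    using assms under_chord_self[of x] unfolding chord_envelope_def by (intro less_cSupD) auto
  then show thesis using that by blast
qed

text \<open>If \<open>q\<close> is below \<open>g x0\<close>, continuity of \<open>g\<close>
  suffices. Otherwise a chord higher than \<open>q\<close> at x0 cannot end at x0, so the same
  segment also covers all nearby points, at nearly the same height.\<close>

lemma chord_envelope_lsc:
  assumes "x0 \<in> D" "q < chord_envelope D g h x0"
  shows "\<forall>\<^sub>F x in at x0. q < chord_envelope D g h x"
proof (cases "q < g x0")
  case True
  have "isCont g x0" using D cont \<open>x0 \<in> D\<close> by (auto simp: continuous_on_eq_continuous_at)
  then have "\<forall>\<^sub>F x in at x0. q < g x" using True by (auto simp: isCont_def intro: order_tendstoD)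
  moreover have "\<forall>\<^sub>F x in at x0. x \<in> D" using D \<open>x0 \<in> D\<close> by (auto intro: eventually_at_in_open')
  ultimately show ?thesis
    by eventually_elim (use chord_envelope_between in force)
next
  case False
  obtain p where p: "under_chord D g h x0 p" "q < p" using less_chord_envelopeD[OF assms] .
  from p(1) obtain y z c where *: "y \<in> D" "z \<in> D" "y \<le> x0" "x0 \<le> z"
    "p + c * (y - x0) \<le> g y" "p + c * (z - x0) \<le> g z"
    "\<And>t. y \<le> t \<Longrightarrow> t \<le> z \<Longrightarrow> p + c * (t - x0) \<le> h t"
    by (rule under_chordE) blast
  have "y \<noteq> x0" "z \<noteq> x0" using * p(2) False by auto
  then have "\<forall>\<^sub>F x in at x0. x \<in> {y<..<z}" using * by (intro eventually_at_in_open') auto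
  moreover have "((\<lambda>x. p + c * (x - x0)) \<longlongrightarrow> p + c * (x0 - x0)) (at x0)"
    by (intro tendsto_intros)
  then have "\<forall>\<^sub>F x in at x0. q < p + c * (x - x0)"
    using p(2) by (intro order_tendstoD) auto
  ultimately show ?thesis
  proof eventually_elim
    case (elim x)
    then have "under_chord D g h x (p + c * (x - x0))"
      using * by (intro under_chord_move[of y D z]) auto
    then show ?case using elim under_chord_le_envelope by fastforce
  qed
qed

lemma chord_envelope_usc:
  assumes "x0 \<in> D" "chord_envelope D g h x0 < q"
  shows "\<forall>\<^sub>F x in at x0. chord_envelope D g h x < q"
proof -
  let ?A = "chord_envelope D g h x0"
  \<comment> \<open>A supremum of heights obeys only a non-strict bound; half the gap leaves room
    for strictness.\<close>
  define \<eta> where "\<eta> = (q - ?A) / 2"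
  have "0 < \<eta>" using assms by (simp add: \<eta>_def)
  obtain \<delta> where \<delta>: "0 < \<delta>"
    "\<And>x p. \<bar>x - x0\<bar> < \<delta> \<Longrightarrow> under_chord D g h x p \<Longrightarrow> p \<le> ?A + \<eta>"
    using under_chord_usc[OF D assms(1) cont under_chord_le_envelope
        chord_envelope_between(1)[OF assms(1)] \<open>0 < \<eta>\<close>] by blast
  have "\<forall>\<^sub>F x in at x0. x \<in> D" using D \<open>x0 \<in> D\<close> by (auto intro: eventually_at_in_open')
  moreover have "\<forall>\<^sub>F x in at x0. \<bar>x - x0\<bar> < \<delta>"
    using \<delta>(1) by (auto simp: eventually_at dist_real_def)
  ultimately show ?thesis
  proof eventually_elim
    case (elim x)
    then have "chord_envelope D g h x \<le> ?A + \<eta>" using \<delta>(2) by (intro chord_envelope_le) auto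
    then show ?case using assms by (simp add: \<eta>_def field_simps)
  qed
qed

lemma continuous_on_chord_envelope: "continuous_on D (chord_envelope D g h)"
  using D chord_envelope_lsc chord_envelope_usc
  by (auto simp: continuous_on_eq_continuous_at isCont_def intro: order_tendstoI)

text \<open>
  If the envelope dropped below one of its chords, lift the lowest parallel supporting segment a
  little: its ends stay under chords of the tube, so it extends to a chord beating the envelope.
\<close>
lemma chord_envelope_concave:
  assumes "s \<le> x" "x \<le> t" "s < t" "{s..t} \<subseteq> D"
    and free: "\<And>\<tau>. s \<le> \<tau> \<Longrightarrow> \<tau> \<le> t \<Longrightarrow> chord_envelope D g h \<tau> < h \<tau>"
  shows "chord_envelope D g h s * ((t - x) / (t - s)) + chord_envelope D g h t * ((x - s) / (t - s))
    \<le> chord_envelope D g h x"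
proof -
  let ?v = "chord_envelope D g h"
  define d where "d = (?v t - ?v s) / (t - s)"
  define K where "K \<tau> = ?v s + d * (\<tau> - s)" for \<tau>
  have K: "K s = ?v s" "K t = ?v t" using \<open>s < t\<close> by (auto simp: K_def d_def)
  have "?v s * ((t - x) / (t - s)) + ?v t * ((x - s) / (t - s)) = K x"
    using \<open>s < t\<close> by (simp add: K_def d_def divide_simps) (simp add: algebra_simps)
  moreover have "K x \<le> ?v x"
  proof (rule ccontr)
    assume "\<not> K x \<le> ?v x"
    have contv: "continuous_on {s..t} ?v"
      using continuous_on_chord_envelope assms(4) by (rule continuous_on_subset)
    have contK: "continuous_on {s..t} K" unfolding K_def by (intro continuous_intros)
    \<comment> \<open>Here the deficit of the envelope below \<open>K\<close> is largest, so
      \<open>K - m\<close> supports the envelope from below on [s, t] and touches it at x0.\<close>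
    obtain x0 where x0: "x0 \<in> {s..t}" "\<And>\<tau>. \<tau> \<in> {s..t} \<Longrightarrow> K \<tau> - ?v \<tau> \<le> K x0 - ?v x0"
      using continuous_attains_sup[OF _ _ continuous_on_diff[OF contK contv]] assms(3) by auto
    define m where "m = K x0 - ?v x0"
    have "0 < m" using x0(2)[of x] \<open>\<not> K x \<le> ?v x\<close> assms by (simp add: m_def)
    have Kv: "K \<tau> - m \<le> ?v \<tau>" if "\<tau> \<in> {s..t}" for \<tau> using x0(2)[OF that] by (simp add: m_def)
    have conth: "continuous_on {s..t} h" using cont(2) assms(4) by (rule continuous_on_subset)
    obtain x1 where x1: "x1 \<in> {s..t}" "\<And>\<tau>. \<tau> \<in> {s..t} \<Longrightarrow> h x1 - K x1 \<le> h \<tau> - K \<tau>"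
      using continuous_attains_inf[OF _ _ continuous_on_diff[OF conth contK]] assms(3) by auto
    \<comment> \<open>The amount of lifting. Being less than \<open>m\<close>, it keeps the lifted
      line below \<open>K\<close> at both ends; the second bound keeps the line below
      \<open>h\<close> on [s, t]. It is positive because \<open>K - m\<close> is below the envelope,
      which is strictly below \<open>h\<close>.\<close>
    define \<epsilon> where "\<epsilon> = min (m / 2) (h x1 - K x1 + m)"
    have "0 < h x1 - K x1 + m" using Kv[OF x1(1)] free[of x1] x1(1) by auto
    then have \<epsilon>: "0 < \<epsilon>" "\<epsilon> < m" "\<epsilon> \<le> h x1 - K x1 + m"
      using \<open>0 < m\<close> by (auto simp: \<epsilon>_def min_def)
    define q where "q = ?v x0 + \<epsilon>"
    have J: "q + d * (\<tau> - x0) = K \<tau> - m + \<epsilon>" for \<tau>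
      by (simp add: q_def m_def K_def algebra_simps)
    have Jh: "q + d * (\<tau> - x0) \<le> h \<tau>" if "\<tau> \<in> {s..t}" for \<tau>
      unfolding J using x1(2)[OF that] \<epsilon>(3) by linarith
    have max: "p' < q" if "under_chord D g h x0 p'" for p'
      using under_chord_le_envelope[OF that] \<epsilon>(1) by (simp add: q_def)
    have inD: "s \<in> D" "t \<in> D" using assms(3,4) by auto
    \<comment> \<open>At the ends the lifted line is strictly below the envelope, so genuine chords
      pass above it there.\<close>
    obtain p1 where p1: "under_chord D g h s p1" "q + d * (s - x0) < p1"
      by (rule less_chord_envelopeD[OF inD(1), of "q + d * (s - x0)"]) (use J[of s] K \<epsilon> in auto)
    obtain p2 where p2: "under_chord D g h t p2" "q + d * (t - x0) < p2"
      by (rule less_chord_envelopeD[OF inD(2), of "q + d * (t - x0)"]) (use J[of t] K \<epsilon> in auto)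
    obtain y where y: "y \<in> D" "y \<le> x0" "q + d * (y - x0) \<le> g y"
      "\<And>\<tau>. y \<le> \<tau> \<Longrightarrow> \<tau> \<le> x0 \<Longrightarrow> q + d * (\<tau> - x0) \<le> h \<tau>"
      by (rule under_chord_extend_left[OF p1]) (use x0 Jh max in auto)
    obtain z where z: "z \<in> D" "x0 \<le> z" "q + d * (z - x0) \<le> g z"
      "\<And>\<tau>. x0 \<le> \<tau> \<Longrightarrow> \<tau> \<le> z \<Longrightarrow> q + d * (\<tau> - x0) \<le> h \<tau>"
      by (rule under_chord_extend_right[OF p2]) (use x0 Jh max in auto)
    have "under_chord D g h x0 q"
      by (rule under_chordI[of y D z _ _ d]) (use y z in \<open>auto, meson linear\<close>)
    then show False using max by blast
  qed
  ultimately show ?thesis by simp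
qed

end

section \<open>Constrained biconjugates\<close>

text \<open>By continuity the supremum is attained when there is a touching point at all. The
  default value 0 is never a touching point, so the two cases cannot be confused.\<close>

lemma left_touch_cases:
  fixes f :: "real \<Rightarrow> real"
  assumes "0 < x" "continuous_on {0<..} f"
  obtains (none) "left_touch f x c p = 0" "\<And>t. 0 < t \<Longrightarrow> t \<le> x \<Longrightarrow> f t \<noteq> p + c * (t - x)"
  | (touch) l where "left_touch f x c p = l" "0 < l" "l \<le> x" "f l = p + c * (l - x)"
    "\<And>t. l < t \<Longrightarrow> t \<le> x \<Longrightarrow> f t \<noteq> p + c * (t - x)"
proof -
  define S where "S = {z. 0 < z \<and> z \<le> x \<and> f z - p = c * (z - x)}"
  have eq: "left_touch f x c p = (if S = {} then 0 else Sup S)"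
    unfolding left_touch_def S_def by (simp only: Let_def)
  show thesis
  proof (cases "S = {}")
    case True
    then have "t \<notin> S" for t by simp
    then have "f t \<noteq> p + c * (t - x)" if "0 < t" "t \<le> x" for t
      using that by (fastforce simp: S_def)
    with True show thesis by (intro none) (auto simp: eq)
  next
    case False
    then obtain z where z: "z \<in> S" by blast
    \<comment> \<open>Since \<open>f\<close> is continuous only on the open half-line,
      \<open>S\<close> need not be closed at 0. Cutting it off at one of its elements gives a closed
      set with the same supremum.\<close>
    define T where "T = {t \<in> {z..x}. f t - p - c * (t - x) = 0}"
    have "continuous_on {z..x} (\<lambda>t. f t - p - c * (t - x))"
      using z by (auto simp: S_def intro!: continuous_intros continuous_on_subset[OF assms(2)])
    then have "closed T" unfolding T_def by (intro continuous_closed_preimage_constant) auto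
    have T: "T \<subseteq> S" "z \<in> T" "bdd_above T" "bdd_above S" using z by (auto simp: T_def S_def bdd_above_def)
    have "Sup S = Sup T"
    proof (rule antisym)
      show "Sup S \<le> Sup T"
      proof (rule cSup_least)
        fix t assume "t \<in> S"
        show "t \<le> Sup T"
        proof (cases "z \<le> t")
          case True
          then show ?thesis using \<open>t \<in> S\<close> T by (intro cSup_upper) (auto simp: T_def S_def)
        next
          case False
          then show ?thesis using cSup_upper[OF T(2,3)] by linarith
        qed
      qed (use False in auto)
      show "Sup T \<le> Sup S" using T by (intro cSup_subset_mono) auto
    qed
    moreover have "Sup T \<in> T" using closed_contains_Sup[of T] T \<open>closed T\<close> by auto
    ultimately have "Sup S \<in> S" using T by auto
    show thesis
    proof (rule touch[of "Sup S"])
      fix t assume t: "Sup S < t" "t \<le> x"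
      then have "t \<notin> S" using cSup_upper[of t S] T by force
      then show "f t \<noteq> p + c * (t - x)" using t \<open>Sup S \<in> S\<close> by (auto simp: S_def)
    qed (use \<open>Sup S \<in> S\<close> False eq in \<open>auto simp: S_def\<close>)
  qed
qed

lemma right_touch_cases:
  fixes f :: "real \<Rightarrow> real"
  assumes "0 < x" "continuous_on {0<..} f"
  obtains (none) "right_touch f x c p = \<infinity>" "\<And>t. x \<le> t \<Longrightarrow> f t \<noteq> p + c * (t - x)"
  | (touch) r where "right_touch f x c p = ereal r" "x \<le> r" "f r = p + c * (r - x)"
    "\<And>t. x \<le> t \<Longrightarrow> t < r \<Longrightarrow> f t \<noteq> p + c * (t - x)"
proof -
  define S where "S = {z. x \<le> z \<and> f z - p = c * (z - x)}"
  have eq: "right_touch f x c p = (INF y\<in>S. ereal y)"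
    by (simp add: right_touch_def S_def)
  show thesis
  proof (cases "S = {}")
    case True
    then have "t \<notin> S" for t by simp
    then have "f t \<noteq> p + c * (t - x)" if "x \<le> t" for t
      using that by (fastforce simp: S_def)
    with True show thesis by (intro none) (auto simp: eq top_ereal_def)
  next
    case False
    have "continuous_on {x..} (\<lambda>t. f t - p - c * (t - x))"
      using assms(1) by (auto intro!: continuous_intros continuous_on_subset[OF assms(2)])
    then have "closed {t \<in> {x..}. f t - p - c * (t - x) = 0}"
      by (intro continuous_closed_preimage_constant) auto
    also have "{t \<in> {x..}. f t - p - c * (t - x) = 0} = S" by (auto simp: S_def)
    finally have "closed S" .
    have bdd: "bdd_below S" by (auto simp: S_def bdd_below_def)
    have "Inf S \<in> S" using closed_contains_Inf[OF False bdd \<open>closed S\<close>] .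
    have "(INF y\<in>S. ereal y) = ereal (Inf S)"
      using \<open>Inf S \<in> S\<close> cInf_lower[OF _ bdd] by (intro antisym INF_greatest INF_lower) auto
    show thesis
    proof (rule touch[of "Inf S"])
      fix t assume t: "t < Inf S" "x \<le> t"
      then have "t \<notin> S" using cInf_lower[of t S] bdd by force
      then show "f t \<noteq> p + c * (t - x)" using t by (auto simp: S_def)
    qed (use \<open>Inf S \<in> S\<close> eq \<open>(INF y\<in>S. ereal y) = ereal (Inf S)\<close> in \<open>auto simp: S_def\<close>)
  qed
qed

text \<open>The intermediate value theorem. Using \<open>closed_segment\<close> lets t lie on either
  side of x.\<close>

lemma less_line_if_not_touching:
  fixes f :: "real \<Rightarrow> real"
  assumes "continuous_on (closed_segment t x) f" "f x \<le> p"
    and no: "\<And>\<tau>. \<tau> \<in> closed_segment t x \<Longrightarrow> f \<tau> \<noteq> p + c * (\<tau> - x)"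
  shows "f t < p + c * (t - x)"
proof (rule ccontr)
  assume "\<not> ?thesis"
  then have ge: "0 \<le> f t - (p + c * (t - x))" by simp
  let ?d = "\<lambda>\<tau>. f \<tau> - (p + c * (\<tau> - x))"
  have "connected (?d ` closed_segment t x)"
    using assms(1) by (intro connected_continuous_image connected_segment continuous_intros)
  moreover have "?d t \<in> ?d ` closed_segment t x" "?d x \<in> ?d ` closed_segment t x"
    by (intro imageI ends_in_segment)+
  ultimately have "0 \<in> ?d ` closed_segment t x"
    using ge assms(2) connectedD_interval[of "?d ` closed_segment t x" "?d x" "?d t" 0] by simp
  then show False using no by auto
qed

lemma line_less_if_not_touching:
  fixes f :: "real \<Rightarrow> real"
  assumes "continuous_on (closed_segment t x) f" "p \<le> f x"
    and no: "\<And>\<tau>. \<tau> \<in> closed_segment t x \<Longrightarrow> f \<tau> \<noteq> p + c * (\<tau> - x)"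
  shows "p + c * (t - x) < f t"
  using less_line_if_not_touching[of t x "\<lambda>\<tau>. - f \<tau>" "- p" "- c"] assms
  by (force intro: continuous_intros simp: algebra_simps)

text \<open>If \<open>u\<close> were below the line at x, take the last point s before x and the
  first point t after x where it is not. Between them \<open>u\<close> is below the line and hence
  below \<open>h\<close>, so concavity is available there and lifts \<open>u x\<close> to the
  line.\<close>

lemma line_le_concave_obstacle:
  fixes u h :: "real \<Rightarrow> real"
  assumes "t1 \<le> x" "x \<le> t2" and contu: "continuous_on {t1..t2} u"
    and ends: "p + c * (t1 - x) \<le> u t1" "p + c * (t2 - x) \<le> u t2"
    and below: "\<And>t. t1 \<le> t \<Longrightarrow> t \<le> t2 \<Longrightarrow> p + c * (t - x) < h t"
    and concave: "\<And>s t. t1 \<le> s \<Longrightarrow> s < x \<Longrightarrow> x < t \<Longrightarrow> t \<le> t2 \<Longrightarrow> (\<And>\<tau>. s \<le> \<tau> \<Longrightarrow> \<tau> \<le> t \<Longrightarrow> u \<tau> < h \<tau>) \<Longrightarrow>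
      u s * ((t - x) / (t - s)) + u t * ((x - s) / (t - s)) \<le> u x"
  shows "p \<le> u x"
proof (rule ccontr)
  assume neg: "\<not> p \<le> u x"
  let ?L = "\<lambda>t. p + c * (t - x)"
  have contd: "continuous_on {t1..t2} (\<lambda>t. u t - ?L t)" by (intro continuous_intros contu)
  define S where "S = {t \<in> {t1..x}. u t - ?L t \<in> {0..}}"
  define T where "T = {t \<in> {x..t2}. u t - ?L t \<in> {0..}}"
  have "continuous_on {t1..x} (\<lambda>t. u t - ?L t)" "continuous_on {x..t2} (\<lambda>t. u t - ?L t)"
    using contd assms(1,2) by (auto intro: continuous_on_subset)
  then have closed: "closed S" "closed T"
    unfolding S_def T_def
    by (intro continuous_closed_preimage[unfolded vimage_def Int_def mem_Collect_eq]; auto)+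
  have ne: "S \<noteq> {}" "T \<noteq> {}" using assms(1,2) ends by (auto simp: S_def T_def)
  have bdd: "bdd_above S" "bdd_below T" by (auto simp: S_def T_def bdd_above_def bdd_below_def)
  define s where "s = Sup S"
  define t where "t = Inf T"
  have s: "s \<in> S" unfolding s_def using closed_contains_Sup[OF ne(1) bdd(1) closed(1)] .
  have t: "t \<in> T" unfolding t_def using closed_contains_Inf[OF ne(2) bdd(2) closed(2)] .
  have st: "t1 \<le> s" "s < x" "x < t" "t \<le> t2" "?L s \<le> u s" "?L t \<le> u t"
    using s t neg by (auto simp: S_def T_def less_le)
  have inner: "u \<tau> < ?L \<tau>" if "s < \<tau>" "\<tau> < t" for \<tau>
  proof (rule ccontr)
    assume "\<not> ?thesis"
    then have "\<tau> \<in> S \<or> \<tau> \<in> T" using that st by (auto simp: S_def T_def)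
    then show False using that cSup_upper[OF _ bdd(1)] cInf_lower[OF _ bdd(2)]
      by (fastforce simp: s_def t_def)
  qed
  \<comment> \<open>Continuity carries the bound to the ends s and t, as \<open>u < h\<close> is
    needed on the closed interval.\<close>
  have "u \<tau> - ?L \<tau> \<le> 0" if "\<tau> \<in> {s..t}" for \<tau>
  proof (rule continuous_le_on_closure[where S="{s<..<t}" and f="\<lambda>\<tau>. u \<tau> - ?L \<tau>"])
    show "continuous_on (closure {s<..<t}) (\<lambda>t. u t - ?L t)"
      using st contd by (auto intro: continuous_on_subset)
  qed (use that st inner in \<open>auto simp: less_imp_le\<close>)
  then have "u \<tau> < h \<tau>" if "s \<le> \<tau>" "\<tau> \<le> t" for \<tau> using below[of \<tau>] that st by force
  then have "u s * ((t - x) / (t - s)) + u t * ((x - s) / (t - s)) \<le> u x"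
    using st by (intro concave) auto
  moreover have "?L s * ((t - x) / (t - s)) + ?L t * ((x - s) / (t - s)) \<le>
      u s * ((t - x) / (t - s)) + u t * ((x - s) / (t - s))"
    using st by (intro add_mono mult_right_mono) auto
  moreover have "?L s * ((t - x) / (t - s)) + ?L t * ((x - s) / (t - s)) = p"
    using st by (simp add: divide_simps) (simp add: algebra_simps)
  ultimately show False using neg by simp
qed

context
  fixes g h :: "real \<Rightarrow> real"
  assumes cont: "continuous_on {0<..} g" "continuous_on {0<..} h"
    and le: "\<And>t. 0 < t \<Longrightarrow> g t \<le> h t"
begin

text \<open>
  The line through (x, p) is lowered by \<open>\<epsilon> * (1 + t)\<close>: this makes it drop below \<open>u\<close> near 0 and near
  infinity, where \<open>h - g\<close> is negligible, in case the line never touches \<open>g\<close> there.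
\<close>
lemma lower_admissible_le:
  assumes "0 < x" and contu: "continuous_on {0<..} u" and gu: "\<And>t. 0 < t \<Longrightarrow> g t \<le> u t"
    and zero: "\<And>\<epsilon>. 0 < \<epsilon> \<Longrightarrow> \<exists>\<delta>>0. \<forall>t. 0 < t \<and> t < \<delta> \<longrightarrow> h t - g t < \<epsilon>"
    and infinity: "\<And>\<epsilon>. 0 < \<epsilon> \<Longrightarrow> \<exists>N. \<forall>t>N. h t - g t < \<epsilon> * t"
    and concave: "\<And>s t. 0 < s \<Longrightarrow> s < x \<Longrightarrow> x < t \<Longrightarrow> (\<And>\<tau>. s \<le> \<tau> \<Longrightarrow> \<tau> \<le> t \<Longrightarrow> u \<tau> < h \<tau>) \<Longrightarrow>
      u s * ((t - x) / (t - s)) + u t * ((x - s) / (t - s)) \<le> u x"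
    and y: "y \<in> lower_admissible g h x c"
  shows "c * (x - y) + g y \<le> u x"
proof -
  from y obtain p where p: "g x \<le> p" "p \<le> h x" and "0 < y"
    and left: "left_touch h x c p \<le> left_touch g x c p" "left_touch g x c p \<le> y"
    and right: "ereal y \<le> right_touch g x c p" "right_touch g x c p \<le> right_touch h x c p"
    by (auto simp: lower_admissible_def)
  let ?L = "\<lambda>t. p + c * (t - x)"
  have cs: "continuous_on (closed_segment t x) g" "continuous_on (closed_segment t x) h" if "0 < t" for t
    using that \<open>0 < x\<close> by (auto intro!: continuous_on_subset[OF cont(1)] continuous_on_subset[OF cont(2)]
        simp: closed_segment_eq_real_ivl split: if_splits)
  define l where "l = left_touch g x c p"
  \<comment> \<open>Between x and its nearest contact with \<open>g\<close> the line meets neither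
    obstacle, and it starts between them at x; so it stays strictly inside the tube.\<close>
  have between_left: "g t < ?L t" "?L t < h t" if "0 < t" "l < t" "t \<le> x" for t
  proof -
    have nog: "g \<tau> \<noteq> ?L \<tau>" if "\<tau> \<in> closed_segment t x" for \<tau>
      using that \<open>0 < t\<close> \<open>l < t\<close> \<open>t \<le> x\<close> unfolding l_def
      by (cases rule: left_touch_cases[OF \<open>0 < x\<close> cont(1), of c p]) (auto simp: closed_segment_eq_real_ivl)
    have noh: "h \<tau> \<noteq> ?L \<tau>" if "\<tau> \<in> closed_segment t x" for \<tau>
      using that \<open>0 < t\<close> \<open>l < t\<close> \<open>t \<le> x\<close> left(1) unfolding l_def
      by (cases rule: left_touch_cases[OF \<open>0 < x\<close> cont(2), of c p]) (auto simp: closed_segment_eq_real_ivl)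
    show "g t < ?L t" using cs[OF \<open>0 < t\<close>] p nog by (intro less_line_if_not_touching) auto
    show "?L t < h t" using cs[OF \<open>0 < t\<close>] p noh by (intro line_less_if_not_touching) auto
  qed
  have between_right: "g t < ?L t" "?L t < h t" if "x \<le> t" "ereal t < right_touch g x c p" for t
  proof -
    have "0 < t" using that \<open>0 < x\<close> by simp
    have seg: "closed_segment t x = {x..t}"
      using \<open>x \<le> t\<close> by (auto simp: closed_segment_eq_real_ivl)
    have nog: "g \<tau> \<noteq> ?L \<tau>" if "\<tau> \<in> closed_segment t x" for \<tau>
      using that seg \<open>ereal t < right_touch g x c p\<close>
      by (cases rule: right_touch_cases[OF \<open>0 < x\<close> cont(1), of c p]) auto
    have noh: "h \<tau> \<noteq> ?L \<tau>" if "\<tau> \<in> closed_segment t x" for \<tau>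
      using that seg less_le_trans[OF \<open>ereal t < right_touch g x c p\<close> right(2)]
      by (cases rule: right_touch_cases[OF \<open>0 < x\<close> cont(2), of c p]) auto
    show "g t < ?L t" using cs[OF \<open>0 < t\<close>] p nog by (intro less_line_if_not_touching) auto
    show "?L t < h t" using cs[OF \<open>0 < t\<close>] p noh by (intro line_less_if_not_touching) auto
  qed
  \<comment> \<open>The parallel to the line through (y, g y) therefore has height at most
    \<open>p\<close> at x, and it remains to compare \<open>p\<close> with
    \<open>u x\<close>.\<close>
  have "g y \<le> ?L y"
  proof (cases "y \<le> x")
    case True
    show ?thesis
    proof (cases "l < y")
      case False
      then have "y = l" using left by (simp add: l_def)
      then show ?thesis using \<open>0 < y\<close> unfolding l_def
        by (cases rule: left_touch_cases[OF \<open>0 < x\<close> cont(1), of c p]) auto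
    qed (use between_left[of y] True \<open>0 < y\<close> in auto)
  next
    case False
    show ?thesis
    proof (cases "ereal y < right_touch g x c p")
      case inner: False
      then have "ereal y = right_touch g x c p" using right by simp
      then show ?thesis
        by (cases rule: right_touch_cases[OF \<open>0 < x\<close> cont(1), of c p]) auto
    qed (use between_right[of y] False in auto)
  qed
  then have "c * (x - y) + g y \<le> p" by (simp add: algebra_simps)
  also have "p \<le> u x"
  proof (rule field_le_epsilon)
    fix e :: real assume "0 < e"
    \<comment> \<open>Chosen so that the lowering \<open>\<epsilon> * (1 + x)\<close> at x is
      exactly \<open>e\<close>.\<close>
    define \<epsilon> where "\<epsilon> = e / (1 + x)"
    have "0 < \<epsilon>" using \<open>0 < e\<close> \<open>0 < x\<close> by (simp add: \<epsilon>_def)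
    \<comment> \<open>A left end for the comparison: the contact point with \<open>g\<close> if
      there is one; otherwise a point so near 0 that the line, being below \<open>h\<close>, exceeds
      \<open>g\<close> by less than \<epsilon>.\<close>
    have "\<exists>t1>0. t1 \<le> x \<and> ?L t1 - \<epsilon> \<le> u t1 \<and> (\<forall>t. t1 \<le> t \<and> t \<le> x \<longrightarrow> ?L t \<le> h t)"
    proof (cases rule: left_touch_cases[OF \<open>0 < x\<close> cont(1), of c p, case_names none touch])
      case none
      obtain \<delta> where \<delta>: "\<delta> > 0" "\<And>t. 0 < t \<Longrightarrow> t < \<delta> \<Longrightarrow> h t - g t < \<epsilon>"
        using zero[OF \<open>0 < \<epsilon>\<close>] by blast
      define t1 where "t1 = min x (\<delta> / 2)"
      have t1: "0 < t1" "t1 \<le> x" "t1 < \<delta>" using \<delta>(1) \<open>0 < x\<close> by (auto simp: t1_def)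
      have "?L t1 < h t1" using t1 none by (intro between_left) (auto simp: l_def)
      then have "?L t1 - \<epsilon> \<le> u t1" using t1 \<delta>(2)[of t1] gu[of t1] by linarith
      then show ?thesis
        using t1 between_left(2) none(1)
        by (intro exI[of _ t1]) (auto simp: l_def less_imp_le)
    next
      case (touch l')
      then have "l = l'" "?L l \<le> h l" using le[of l] by (auto simp: l_def)
      then show ?thesis
        using touch gu[of l] between_left(2) \<open>0 < \<epsilon>\<close>
        by (intro exI[of _ l]) (auto simp: less_imp_le le_less)
    qed
    then obtain t1 where t1: "0 < t1" "t1 \<le> x" "?L t1 - \<epsilon> \<le> u t1"
      "\<And>t. t1 \<le> t \<Longrightarrow> t \<le> x \<Longrightarrow> ?L t \<le> h t" by blast
    \<comment> \<open>The same on the right, where the tolerated excess over \<open>g\<close> is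
      \<open>\<epsilon> * t2\<close>.\<close>
    have "\<exists>t2\<ge>x. ?L t2 - \<epsilon> * t2 \<le> u t2 \<and> (\<forall>t. x \<le> t \<and> t \<le> t2 \<longrightarrow> ?L t \<le> h t)"
    proof (cases rule: right_touch_cases[OF \<open>0 < x\<close> cont(1), of c p, case_names none touch])
      case none
      obtain N where N: "\<And>t. N < t \<Longrightarrow> h t - g t < \<epsilon> * t"
        using infinity[OF \<open>0 < \<epsilon>\<close>] by blast
      define t2 where "t2 = max x (N + 1)"
      have t2: "x \<le> t2" "N < t2" by (auto simp: t2_def)
      have "?L t2 < h t2" using t2 none by (intro between_right) auto
      then have "?L t2 - \<epsilon> * t2 \<le> u t2"
        using t2 N[of t2] gu[of t2] \<open>0 < x\<close> by (simp add: less_imp_le)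
      then show ?thesis
        using t2 between_right(2) none(1)
        by (intro exI[of _ t2]) (auto simp: less_imp_le)
    next
      case (touch r)
      have "?L r \<le> h r" using touch le[of r] \<open>0 < x\<close> by simp
      moreover have "?L r - \<epsilon> * r \<le> u r"
        using touch gu[of r] \<open>0 < x\<close> mult_pos_pos[OF \<open>0 < \<epsilon>\<close>, of r] by auto
      ultimately show ?thesis
        using touch between_right(2)
        by (intro exI[of _ r]) (auto simp: less_imp_le le_less)
    qed
    then obtain t2 where t2: "x \<le> t2" "?L t2 - \<epsilon> * t2 \<le> u t2"
      "\<And>t. x \<le> t \<Longrightarrow> t \<le> t2 \<Longrightarrow> ?L t \<le> h t" by blast
    have shift: "p - \<epsilon> * (1 + x) + (c - \<epsilon>) * (t - x) = ?L t - \<epsilon> - \<epsilon> * t" for t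
      by (simp add: algebra_simps)
    have pos: "0 < \<epsilon> * t" if "0 < t" for t using that \<open>0 < \<epsilon>\<close> by simp
    have "p - \<epsilon> * (1 + x) \<le> u x"
    proof (rule line_le_concave_obstacle[where h=h and c="c - \<epsilon>", OF t1(2) t2(1)])
      show "continuous_on {t1..t2} u" using contu t1 by (auto intro: continuous_on_subset)
      show "p - \<epsilon> * (1 + x) + (c - \<epsilon>) * (t1 - x) \<le> u t1"
        unfolding shift using t1 pos[of t1] by linarith
      show "p - \<epsilon> * (1 + x) + (c - \<epsilon>) * (t2 - x) \<le> u t2"
        unfolding shift using t2 \<open>0 < \<epsilon>\<close> by linarith
      show "p - \<epsilon> * (1 + x) + (c - \<epsilon>) * (t - x) < h t" if "t1 \<le> t" "t \<le> t2" for t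
      proof -
        have "?L t \<le> h t" using that t1(4)[of t] t2(3)[of t] by (cases "t \<le> x") auto
        then show ?thesis
          unfolding shift using that t1(1) \<open>0 < \<epsilon>\<close> pos[of t] by linarith
      qed
    qed (use t1 concave in auto)
    then show "p \<le> u x + e" using \<open>0 < x\<close> by (simp add: \<epsilon>_def)
  qed
  finally show ?thesis .
qed

text \<open>After lowering from \<open>p\<close> to \<open>q\<close>, the line misses
  \<open>h\<close> on all of [y, z]. It is above \<open>g\<close> at x or touches it there by
  \<open>g x < q\<close>, yet below \<open>g\<close> at both ends, so it meets \<open>g\<close>
  within [y, z] on either side. The nearest contact on the left is then an admissible point whose
  value is \<open>q\<close>.\<close>

lemma under_chord_le_biconj_lower:
  assumes "0 < x" and p: "under_chord {0<..} g h x p" and q: "g x < q" "q < p"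
  shows "ereal q \<le> biconj_lower g h x"
  using p
proof (rule under_chordE)
  fix y z c
  assume *: "y \<in> {0<..}" "z \<in> {0<..}" "y \<le> x" "x \<le> z"
    "p + c * (y - x) \<le> g y" "p + c * (z - x) \<le> g z"
    "\<And>t. y \<le> t \<Longrightarrow> t \<le> z \<Longrightarrow> p + c * (t - x) \<le> h t"
  have cs: "continuous_on (closed_segment t x) g" if "0 < t" for t
    using that \<open>0 < x\<close> by (auto intro!: continuous_on_subset[OF cont(1)]
        simp: closed_segment_eq_real_ivl split: if_splits)
  have noh: "h t \<noteq> q + c * (t - x)" if "y \<le> t" "t \<le> z" for t using *(7)[OF that] q(2) by auto
  have "\<exists>\<tau>\<in>closed_segment y x. g \<tau> = q + c * (\<tau> - x)"
    using less_line_if_not_touching[OF cs[of y], of q c] * q by force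
  then obtain \<tau> where \<tau>: "y \<le> \<tau>" "\<tau> \<le> x" "g \<tau> = q + c * (\<tau> - x)"
    using *(3) by (auto simp: closed_segment_eq_real_ivl)
  have seg: "closed_segment z x = {x..z}"
    using *(4) by (auto simp: closed_segment_eq_real_ivl)
  have "\<exists>\<tau>\<in>closed_segment z x. g \<tau> = q + c * (\<tau> - x)"
    using less_line_if_not_touching[OF cs[of z], of q c] * q by force
  then obtain \<sigma> where \<sigma>: "x \<le> \<sigma>" "\<sigma> \<le> z" "g \<sigma> = q + c * (\<sigma> - x)"
    using seg by auto
  obtain l where l: "left_touch g x c q = l" "y \<le> l" "l \<le> x" "g l = q + c * (l - x)"
  proof (cases rule: left_touch_cases[OF \<open>0 < x\<close> cont(1), of c q, case_names none touch])
    case (touch l)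
    then have "\<tau> \<le> l" using \<tau> by (meson not_le)
    then show ?thesis using touch \<tau> by (intro that[of l]) auto
  qed (use \<tau> * in auto)
  have lh: "left_touch h x c q \<le> l"
  proof (cases rule: left_touch_cases[OF \<open>0 < x\<close> cont(2), of c q, case_names none touch])
    case (touch l')
    then have "l' < y" using noh[of l'] * by force
    then show ?thesis using touch l by simp
  qed (use l * in auto)
  obtain r where r: "right_touch g x c q = ereal r" "x \<le> r" "r \<le> z"
  proof (cases rule: right_touch_cases[OF \<open>0 < x\<close> cont(1), of c q, case_names none touch])
    case (touch r)
    then have "r \<le> \<sigma>" using \<sigma> by (meson not_le)
    then show ?thesis using touch \<sigma> by (intro that[of r]) auto
  qed (use \<sigma> in auto)
  have rh: "ereal r \<le> right_touch h x c q"
  proof (cases rule: right_touch_cases[OF \<open>0 < x\<close> cont(2), of c q, case_names none touch])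
    case (touch r')
    then have "z < r'" using noh[of r'] * by force
    then show ?thesis using touch r by simp
  qed auto
  have "q \<le> h x" using under_chord_le[OF p] q by simp
  then have "l \<in> lower_admissible g h x c"
    unfolding lower_admissible_def
    by (intro UN_I[of q]) (use l lh r rh q * in auto)
  moreover have "c * (x - l) + g l = q" using l(4) by (simp add: algebra_simps)
  ultimately show ?thesis
    unfolding biconj_lower_def by (intro SUP_upper2[of c] SUP_upper2[of l]) auto
qed

text \<open>A line through (x, g x) touches \<open>g\<close> at x itself, so x is admissible; the
  slope is arbitrary. This also shows that the biconjugate is not a supremum over nothing.\<close>

lemma obstacle_le_biconj_lower:
  assumes "0 < x" shows "ereal (g x) \<le> biconj_lower g h x"
proof -
  have l: "left_touch g x 0 (g x) = x"
    by (cases rule: left_touch_cases[OF \<open>0 < x\<close> cont(1), of 0 "g x"]) (use assms in \<open>auto simp: le_less\<close>)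
  have r: "right_touch g x 0 (g x) = x"
    by (cases rule: right_touch_cases[OF \<open>0 < x\<close> cont(1), of 0 "g x"]) (use assms in \<open>auto simp: le_less\<close>)
  have "left_touch h x 0 (g x) \<le> x"
    by (cases rule: left_touch_cases[OF \<open>0 < x\<close> cont(2), of 0 "g x"]) (use assms in auto)
  moreover have "ereal x \<le> right_touch h x 0 (g x)"
    by (cases rule: right_touch_cases[OF \<open>0 < x\<close> cont(2), of 0 "g x"]) (use assms in auto)
  ultimately have "x \<in> lower_admissible g h x 0"
    unfolding lower_admissible_def using assms le[of x] l r by (intro UN_I[of "g x"]) auto
  then show ?thesis
    unfolding biconj_lower_def by (intro SUP_upper2[of 0] SUP_upper2[of x]) auto
qed

lemma chord_envelope_le_biconj_lower:
  assumes "0 < x"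
  shows "ereal (chord_envelope {0<..} g h x) \<le> biconj_lower g h x"
proof (rule ccontr)
  let ?V = "chord_envelope {0<..} g h x"
  assume "\<not> ?thesis"
  then have "biconj_lower g h x < ereal ?V" by simp
  then obtain q where q: "biconj_lower g h x < ereal q" "q < ?V" by (auto dest: ereal_dense2)
  have "g x < q" using obstacle_le_biconj_lower[OF assms] q(1) by (metis ereal_less_eq(3) le_less_trans less_ereal.simps(1))
  obtain p where "under_chord {0<..} g h x p" "q < p"
    by (rule less_chord_envelopeD[of "{0<..}" g h x q]) (use assms cont le q in auto)
  then have "ereal q \<le> biconj_lower g h x"
    using under_chord_le_biconj_lower[OF assms] \<open>g x < q\<close> by blast
  then show False using q by simp
qed

end

section \<open>Boundary behaviour of the obstacles\<close>

text \<open>The times at which a continuous path visits a point form a closed set, so a finite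
  hitting time is a minimum.\<close>

lemma (in regular_diffusion) hitting_time_attained:
  assumes "\<omega> \<in> space M" "hitting_time X y \<omega> < \<infinity>"
  obtains t where "0 \<le> t" "hitting_time X y \<omega> = ennreal t" "X t \<omega> = y"
proof -
  define S where "S = {t \<in> {0..}. X t \<omega> = y}"
  have eq: "hitting_time X y \<omega> = (INF t\<in>S. ennreal t)"
    by (simp add: hitting_time_def S_def)
  have "S \<noteq> {}" using assms(2) by (auto simp: eq top_ennreal_def)
  moreover have "bdd_below S" by (auto simp: S_def bdd_below_def)
  moreover have "closed S"
    unfolding S_def by (intro continuous_closed_preimage_constant path_continuous assms(1)) simp
  ultimately have "Inf S \<in> S" by (rule closed_contains_Inf)
  moreover have "(INF t\<in>S. ennreal t) = ennreal (Inf S)"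
    using \<open>Inf S \<in> S\<close> cInf_lower[OF _ \<open>bdd_below S\<close>]
    by (intro antisym INF_greatest INF_lower ennreal_leI) auto
  ultimately show thesis by (intro that[of "Inf S"]) (auto simp: eq S_def)
qed

text \<open>
  The supremum over all times in the integrability hypothesis need not be measurable; its
  restriction to rational times, with the function cut off outside the state space, is.
\<close>
lemma (in regular_diffusion) hitting_time_dominated:
  assumes "continuous_on (einterval a b) f" "x \<in> einterval a b"
    and fin: "(\<integral>\<^sup>+\<omega>. (SUP t\<in>{0..}. ennreal \<bar>exp (- r * t) * f (real_of_ereal (X t \<omega>))\<bar>) \<partial>P x) < \<infinity>"
  obtains w where "integrable (P x) w"
    "AE \<omega> in P x. \<forall>y\<in>einterval a b. \<bar>f y * discount_at r (hitting_time X (ereal y) \<omega>)\<bar> \<le> w \<omega>"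
proof -
  let ?I = "einterval a b"
  interpret P: prob_space "P x" using assms(2) by (rule prob_space_P)
  have space: "space (P x) = space M" using sets_P[OF assms(2)] by (rule sets_eq_imp_space_eq)
  \<comment> \<open>\<open>f\<close> is controlled only on the state space; the cut-off function is
    Borel on the whole line.\<close>
  define f' where "f' y = indicator ?I y *\<^sub>R f y" for y
  have f': "f' \<in> borel_measurable borel"
    unfolding f'_def using assms(1) by (intro borel_measurable_continuous_on_indicator) auto
  have X: "X t \<in> borel_measurable (P x)" if "0 \<le> t" for t
  proof -
    have "X t \<in> borel_measurable M"
      using subalgebra_F adapted[OF that] by (rule measurable_from_subalg)
    then show ?thesis using sets_P[OF assms(2)] by (simp cong: measurable_cong_sets)
  qed
  define K where "K \<omega> = (SUP t\<in>{0..} \<inter> \<rat>. ennreal \<bar>exp (- r * t) * f' (real_of_ereal (X t \<omega>))\<bar>)" for \<omega>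
  have [measurable]: "K \<in> borel_measurable (P x)"
    unfolding K_def
  proof (rule borel_measurable_SUP)
    show "countable ({0..} \<inter> \<rat> :: real set)" using countable_rat by (rule countable_Int2)
    fix t :: real assume "t \<in> {0..} \<inter> \<rat>"
    then have [measurable]: "X t \<in> borel_measurable (P x)" by (intro X) auto
    have [measurable]: "(\<lambda>\<omega>. f' (real_of_ereal (X t \<omega>))) \<in> borel_measurable (P x)"
      using f' by (intro measurable_compose[OF _ f']) measurable
    show "(\<lambda>\<omega>. ennreal \<bar>exp (- r * t) * f' (real_of_ereal (X t \<omega>))\<bar>) \<in> borel_measurable (P x)"
      by measurable
  qed
  have "K \<omega> \<le> (SUP t\<in>{0..}. ennreal \<bar>exp (- r * t) * f (real_of_ereal (X t \<omega>))\<bar>)" for \<omega>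
    unfolding K_def by (intro SUP_mono) (auto simp: f'_def indicator_def)
  then have K: "(\<integral>\<^sup>+\<omega>. K \<omega> \<partial>P x) < \<infinity>"
    using fin by (intro le_less_trans[OF nn_integral_mono fin])
  define w where "w \<omega> = enn2real (K \<omega>)" for \<omega>
  have "integrable (P x) w"
  proof (rule integrableI_bounded)
    show "w \<in> borel_measurable (P x)" unfolding w_def by measurable
    have "ennreal (norm (w \<omega>)) \<le> K \<omega>" for \<omega>
      by (cases "K \<omega>") (auto simp: w_def)
    then show "(\<integral>\<^sup>+\<omega>. ennreal (norm (w \<omega>)) \<partial>P x) < \<infinity>"
      by (intro le_less_trans[OF nn_integral_mono K])
  qed
  moreover have "AE \<omega> in P x. K \<omega> \<noteq> \<infinity>" using K by (intro nn_integral_PInf_AE) auto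
  then have "AE \<omega> in P x. \<forall>y\<in>?I. \<bar>f y * discount_at r (hitting_time X (ereal y) \<omega>)\<bar> \<le> w \<omega>"
  proof (rule AE_mp, intro AE_I2 impI ballI)
    fix \<omega> y assume \<omega>: "\<omega> \<in> space (P x)" "K \<omega> \<noteq> \<infinity>" and y: "y \<in> ?I"
    show "\<bar>f y * discount_at r (hitting_time X (ereal y) \<omega>)\<bar> \<le> w \<omega>"
    proof (cases "hitting_time X (ereal y) \<omega> < \<infinity>")
      case True
      then obtain t where t: "0 \<le> t" "hitting_time X (ereal y) \<omega> = ennreal t" "X t \<omega> = ereal y"
        by (rule hitting_time_attained[of \<omega> "ereal y", rotated]) (use \<omega>(1) space in auto)
      \<comment> \<open>Times approach t from the right, since t may be 0. If the discounted value
        at t exceeded \<open>w\<close>, so would the values at rational times just after t, where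
        the path is still in the state space and \<open>f'\<close> agrees with
        \<open>f\<close>.\<close>
      let ?N = "at t within {t..}"
      have "continuous_on {t..} (\<lambda>s. X s \<omega>)"
        using path_continuous \<omega>(1) space t(1) by (auto intro: continuous_on_subset)
      then have lim: "((\<lambda>s. real_of_ereal (X s \<omega>)) \<longlongrightarrow> y) ?N"
        unfolding continuous_on_def using t(3)
        by (intro lim_real_of_ereal) (metis atLeast_iff order_refl)
      have "isCont f y" using assms(1) y by (auto simp: continuous_on_eq_continuous_at)
      then have "((\<lambda>s. \<bar>exp (- r * s) * f (real_of_ereal (X s \<omega>))\<bar>) \<longlongrightarrow> \<bar>exp (- r * t) * f y\<bar>) ?N"
        by (intro tendsto_rabs tendsto_mult tendsto_exp tendsto_const tendsto_ident_at
            isCont_tendsto_compose[OF _ lim])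
      then have above: "\<forall>\<^sub>F s in ?N. w \<omega> < \<bar>exp (- r * s) * f (real_of_ereal (X s \<omega>))\<bar>"
        if "w \<omega> < \<bar>exp (- r * t) * f y\<bar>" using that by (rule order_tendstoD(1))
      have "\<exists>\<^sub>F s in ?N. \<bar>exp (- r * s) * f (real_of_ereal (X s \<omega>))\<bar> \<le> w \<omega>"
        unfolding frequently_def
      proof
        assume "\<forall>\<^sub>F s in ?N. \<not> \<bar>exp (- r * s) * f (real_of_ereal (X s \<omega>))\<bar> \<le> w \<omega>"
        moreover have "\<forall>\<^sub>F s in ?N. real_of_ereal (X s \<omega>) \<in> ?I"
          using lim y by (intro topological_tendstoD) auto
        ultimately have "\<forall>\<^sub>F s in ?N. w \<omega> < \<bar>exp (- r * s) * f' (real_of_ereal (X s \<omega>))\<bar>"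
          by eventually_elim (auto simp: f'_def)
        then obtain \<delta> where \<delta>: "0 < \<delta>"
          "\<forall>s\<in>{t..}. s \<noteq> t \<and> dist s t < \<delta> \<longrightarrow> w \<omega> < \<bar>exp (- r * s) * f' (real_of_ereal (X s \<omega>))\<bar>"
          unfolding eventually_at by blast
        obtain s where s: "s \<in> \<rat>" "t < s" "s < t + \<delta>"
          using Rats_dense_in_real[of t "t + \<delta>"] \<delta>(1) by auto
        have "ennreal \<bar>exp (- r * s) * f' (real_of_ereal (X s \<omega>))\<bar> \<le> K \<omega>"
          unfolding K_def using s t(1) by (intro SUP_upper) auto
        also have "K \<omega> = ennreal (w \<omega>)" using \<omega>(2) by (simp add: w_def less_top)
        finally have "\<bar>exp (- r * s) * f' (real_of_ereal (X s \<omega>))\<bar> \<le> w \<omega>"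
          by (subst (asm) ennreal_le_iff) (auto simp: w_def)
        then show False using bspec[OF \<delta>(2), of s] s by (simp add: dist_real_def)
      qed
      then have "\<bar>exp (- r * t) * f y\<bar> \<le> w \<omega>"
        unfolding frequently_def not_le using above by (rule contrapos_np) simp
      then show ?thesis using t by (simp add: discount_at_def mult.commute)
    qed (auto simp: discount_at_def w_def less_top)
  qed
  ultimately show thesis by (rule that)
qed

text \<open>Almost every path stays strictly between a and b, so up to any fixed time it remains in
  a compact part [c, d] of the state space. Once \<open>y n\<close> has left [c, d], it is hit only
  after that time, when the discounted gap is already small, or never, when the discount is
  0.\<close>

lemma (in regular_diffusion) discounted_gap_AE:
  assumes "x \<in> einterval a b"
    and lim: "AE \<omega> in P x. \<exists>l.
      ((\<lambda>t. exp (- r * t) * f (real_of_ereal (X t \<omega>))) \<longlongrightarrow> l) at_top \<and>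
      ((\<lambda>t. exp (- r * t) * g (real_of_ereal (X t \<omega>))) \<longlongrightarrow> l) at_top"
    and escape: "\<And>c d. c \<in> einterval a b \<Longrightarrow> d \<in> einterval a b \<Longrightarrow> \<forall>\<^sub>F n in sequentially. y n \<notin> {c..d}"
  shows "AE \<omega> in P x. (\<lambda>n. (g (y n) - f (y n)) * discount_at r (hitting_time X (ereal (y n)) \<omega>)) \<longlonglongrightarrow> 0"
  using lim natural_left[OF assms(1)] natural_right[OF assms(1)] AE_space
proof eventually_elim
  case (elim \<omega>)
  have space: "space (P x) = space M" using sets_P[OF assms(1)] by (rule sets_eq_imp_space_eq)
  have \<omega>: "\<omega> \<in> space M" using elim space by simp
  have avoid: "a < X t \<omega>" "X t \<omega> < b" if "0 \<le> t" for t
  proof -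
    have "X t \<omega> \<noteq> c" if "\<not> hitting_time X c \<omega> < \<infinity>" for c
    proof
      assume "X t \<omega> = c"
      then have "hitting_time X c \<omega> \<le> ennreal t"
        unfolding hitting_time_def using \<open>0 \<le> t\<close> by (intro INF_lower) auto
      then show False using that by (auto simp: not_less top_unique)
    qed
    then show "a < X t \<omega>" "X t \<omega> < b" using elim path_range[OF that \<omega>] by (auto simp: less_le)
  qed
  from elim(1) obtain l where l:
    "((\<lambda>t. exp (- r * t) * f (real_of_ereal (X t \<omega>))) \<longlongrightarrow> l) at_top"
    "((\<lambda>t. exp (- r * t) * g (real_of_ereal (X t \<omega>))) \<longlongrightarrow> l) at_top" by blast
  have lim0: "((\<lambda>t. exp (- r * t) * (g (real_of_ereal (X t \<omega>)) - f (real_of_ereal (X t \<omega>)))) \<longlongrightarrow> 0) at_top"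
    using tendsto_diff[OF l(2,1)] by (simp add: algebra_simps)
  show ?case
  proof (rule tendstoI)
    fix \<epsilon> :: real assume "0 < \<epsilon>"
    then have "\<forall>\<^sub>F t in at_top. dist (exp (- r * t) * (g (real_of_ereal (X t \<omega>)) - f (real_of_ereal (X t \<omega>)))) 0 < \<epsilon>"
      by (rule tendstoD[OF lim0])
    then obtain t1 where t1: "\<And>t. t1 \<le> t \<Longrightarrow>
        \<bar>exp (- r * t) * (g (real_of_ereal (X t \<omega>)) - f (real_of_ereal (X t \<omega>)))\<bar> < \<epsilon>"
      by (auto simp: eventually_at_top_linorder)
    define t0 where "t0 = max 0 t1"
    have contX: "continuous_on {0..t0} (\<lambda>t. X t \<omega>)"
      using path_continuous[OF \<omega>] by (rule continuous_on_subset) auto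
    have ne: "{0..t0} \<noteq> {}" by (simp add: t0_def)
    obtain s1 where s1: "s1 \<in> {0..t0}" "\<And>t. t \<in> {0..t0} \<Longrightarrow> X s1 \<omega> \<le> X t \<omega>"
      using continuous_attains_inf[OF compact_Icc ne contX] by blast
    obtain s2 where s2: "s2 \<in> {0..t0}" "\<And>t. t \<in> {0..t0} \<Longrightarrow> X t \<omega> \<le> X s2 \<omega>"
      using continuous_attains_sup[OF compact_Icc ne contX] by blast
    obtain c where c: "a < ereal c" "ereal c < X s1 \<omega>"
      using ereal_dense2[OF avoid(1)[of s1]] s1(1) by auto
    obtain d where d: "X s2 \<omega> < ereal d" "ereal d < b"
      using ereal_dense2[OF avoid(2)[of s2]] s2(1) by auto
    have "ereal c < b" using c(2) avoid(2)[of s1] s1(1) by auto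
    moreover have "a < ereal d" using d(1) avoid(1)[of s2] s2(1) by auto
    ultimately have "\<forall>\<^sub>F n in sequentially. y n \<notin> {c..d}"
      using c d by (intro escape) (auto simp: einterval_def)
    then show "\<forall>\<^sub>F n in sequentially. dist ((g (y n) - f (y n)) * discount_at r (hitting_time X (ereal (y n)) \<omega>)) 0 < \<epsilon>"
    proof eventually_elim
      case (elim n)
      show ?case
      proof (cases "hitting_time X (ereal (y n)) \<omega> < \<infinity>")
        case True
        then obtain t where t: "0 \<le> t" "hitting_time X (ereal (y n)) \<omega> = ennreal t" "X t \<omega> = ereal (y n)"
          by (rule hitting_time_attained[of \<omega> "ereal (y n)", rotated]) (use \<omega> in auto)
        have "t0 < t"
        proof (rule ccontr)
          assume "\<not> t0 < t"
          then have "t \<in> {0..t0}" using t(1) by simp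
          then have "ereal c < ereal (y n)" "ereal (y n) < ereal d"
            using less_le_trans[OF c(2) s1(2)[OF \<open>t \<in> {0..t0}\<close>]]
              le_less_trans[OF s2(2)[OF \<open>t \<in> {0..t0}\<close>] d(1)] by (simp_all add: t(3))
          then show False using elim by simp
        qed
        then show ?thesis using t1[of t] t by (simp add: discount_at_def t0_def mult.commute)
      qed (use \<open>0 < \<epsilon>\<close> in \<open>auto simp: discount_at_def less_top\<close>)
    qed
  qed
qed

lemma (in discounted_diffusion) discounted_gap_tendsto_0:
  assumes x: "x \<in> einterval a b" and y: "\<And>n. y n \<in> einterval a b"
    and cont: "continuous_on (einterval a b) f" "continuous_on (einterval a b) g"
    and fin: "(\<integral>\<^sup>+\<omega>. (SUP t\<in>{0..}. ennreal \<bar>exp (- r * t) * f (real_of_ereal (X t \<omega>))\<bar>) \<partial>P x) < \<infinity>"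
      "(\<integral>\<^sup>+\<omega>. (SUP t\<in>{0..}. ennreal \<bar>exp (- r * t) * g (real_of_ereal (X t \<omega>))\<bar>) \<partial>P x) < \<infinity>"
    and lim: "AE \<omega> in P x. \<exists>l.
      ((\<lambda>t. exp (- r * t) * f (real_of_ereal (X t \<omega>))) \<longlongrightarrow> l) at_top \<and>
      ((\<lambda>t. exp (- r * t) * g (real_of_ereal (X t \<omega>))) \<longlongrightarrow> l) at_top"
    and escape: "\<And>c d. c \<in> einterval a b \<Longrightarrow> d \<in> einterval a b \<Longrightarrow> \<forall>\<^sub>F n in sequentially. y n \<notin> {c..d}"
  shows "(\<lambda>n. (g (y n) - f (y n)) * (\<integral>\<omega>. discount_at r (hitting_time X (ereal (y n)) \<omega>) \<partial>P x)) \<longlonglongrightarrow> 0"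
proof -
  let ?disc = "\<lambda>n \<omega>. discount_at r (hitting_time X (ereal (y n)) \<omega>)"
  \<comment> \<open>The integral of a non-integrable function is 0 by convention, whereas the
    hitting formulas give a positive value. This yields integrability, and with it measurability, of
    the discount.\<close>
  have "(\<integral>\<omega>. ?disc n \<omega> \<partial>P x) \<noteq> 0" for n
    using hit_below[OF x y[of n]] hit_above[OF x y[of n]] phi_pos[OF x] phi_pos[OF y[of n]]
      psi_pos[OF x] psi_pos[OF y[of n]] by (cases "y n < x") auto
  then have "integrable (P x) (?disc n)" for n
    using not_integrable_integral_eq by blast
  then have meas: "?disc n \<in> borel_measurable (P x)" for n by blast
  obtain wf where wf: "integrable (P x) wf"
    "AE \<omega> in P x. \<forall>y\<in>einterval a b. \<bar>f y * discount_at r (hitting_time X (ereal y) \<omega>)\<bar> \<le> wf \<omega>"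
    by (rule hitting_time_dominated[OF cont(1) x fin(1)])
  obtain wg where wg: "integrable (P x) wg"
    "AE \<omega> in P x. \<forall>y\<in>einterval a b. \<bar>g y * discount_at r (hitting_time X (ereal y) \<omega>)\<bar> \<le> wg \<omega>"
    by (rule hitting_time_dominated[OF cont(2) x fin(2)])
  have "(\<lambda>n. \<integral>\<omega>. (g (y n) - f (y n)) * ?disc n \<omega> \<partial>P x) \<longlonglongrightarrow> (\<integral>\<omega>. 0 \<partial>P x)"
  proof (rule integral_dominated_convergence)
    show "integrable (P x) (\<lambda>\<omega>. wf \<omega> + wg \<omega>)" using wf wg by simp
    show "AE \<omega> in P x. (\<lambda>n. (g (y n) - f (y n)) * ?disc n \<omega>) \<longlonglongrightarrow> 0"
      by (rule discounted_gap_AE[OF x lim escape])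
    show "AE \<omega> in P x. norm ((g (y n) - f (y n)) * ?disc n \<omega>) \<le> wf \<omega> + wg \<omega>" for n
      using wf(2) wg(2)
    proof eventually_elim
      case (elim \<omega>)
      then have "\<bar>f (y n) * ?disc n \<omega>\<bar> \<le> wf \<omega>" "\<bar>g (y n) * ?disc n \<omega>\<bar> \<le> wg \<omega>"
        using y[of n] by auto
      then show ?case by (simp add: left_diff_distrib)
    qed
  qed (use meas in auto)
  then show ?thesis by simp
qed

section \<open>Reduction to the natural scale\<close>

lemma Icc_subset_einterval:
  assumes "u \<in> einterval a b" "v \<in> einterval a b"
  shows "{u..v} \<subseteq> einterval a b"
proof
  fix t assume "t \<in> {u..v}"
  then have "ereal u \<le> ereal t" "ereal t \<le> ereal v" by auto
  then show "t \<in> einterval a b"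
    using assms less_le_trans[of a "ereal u" "ereal t"] le_less_trans[of "ereal t" "ereal v" b]
    by (simp add: einterval_iff)
qed

lemma eventually_at_right_einterval:
  assumes "a < b" "\<forall>\<^sub>F e in at_right a. Q (real_of_ereal e)"
  obtains u where "u \<in> einterval a b" "Q u"
proof -
  obtain c where c: "a < c" "\<And>e. a < e \<Longrightarrow> e < c \<Longrightarrow> Q (real_of_ereal e)"
    using assms(2) unfolding eventually_at_right[OF assms(1)] by blast
  have "a < min b c" using assms(1) c(1) by simp
  then obtain u where u: "a < ereal u" "ereal u < min b c" by (blast dest: ereal_dense2)
  with c(2)[of "ereal u"] show thesis by (intro that[of u]) (simp_all add: einterval_iff)
qed

lemma eventually_at_left_einterval:
  assumes "a < b" "\<forall>\<^sub>F e in at_left b. Q (real_of_ereal e)"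
  obtains u where "u \<in> einterval a b" "Q u"
proof -
  obtain c where c: "c < b" "\<And>e. c < e \<Longrightarrow> e < b \<Longrightarrow> Q (real_of_ereal e)"
    using assms(2) unfolding eventually_at_left[OF assms(1)] by blast
  have "max a c < b" using assms(1) c(1) by simp
  then obtain u where u: "max a c < ereal u" "ereal u < b" by (blast dest: ereal_dense2)
  with c(2)[of "ereal u"] show thesis by (intro that[of u]) (simp_all add: einterval_iff)
qed

section \<open>The scale function as an increasing homeomorphism onto the positive half-line\<close>

context discounted_diffusion
begin

abbreviation "scale_fun \<equiv> scale_quot \<phi> \<psi>"

lemma scale_pos: "x \<in> einterval a b \<Longrightarrow> 0 < scale_fun x"
  using phi_pos psi_pos by (simp add: scale_quot_def)

lemma scale_less:
  assumes "x \<in> einterval a b" "y \<in> einterval a b" "x < y" shows "scale_fun x < scale_fun y"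
proof -
  have "\<phi> x < \<phi> y" "\<psi> y < \<psi> x"
    using assms phi_increasing psi_decreasing by (auto simp: strict_mono_on_def monotone_on_def)
  then show ?thesis
    using phi_pos[OF assms(1)] psi_pos[OF assms(2)] unfolding scale_quot_def
    by (intro frac_less) auto
qed

lemma scale_less_iff:
  "x \<in> einterval a b \<Longrightarrow> y \<in> einterval a b \<Longrightarrow> scale_fun x < scale_fun y \<longleftrightarrow> x < y"
  using scale_less[of x y] scale_less[of y x] by (cases x y rule: linorder_cases) auto

lemma scale_le_iff:
  "x \<in> einterval a b \<Longrightarrow> y \<in> einterval a b \<Longrightarrow> scale_fun x \<le> scale_fun y \<longleftrightarrow> x \<le> y"
  using scale_less_iff[of y x] by (meson not_less)

lemma inj_on_scale: "inj_on scale_fun (einterval a b)"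
proof (rule inj_onI)
  fix x y assume "x \<in> einterval a b" "y \<in> einterval a b" "scale_fun x = scale_fun y"
  then show "x = y"
    using scale_less[of x y] scale_less[of y x] by (cases x y rule: linorder_cases) auto
qed

lemma continuous_on_scale: "continuous_on (einterval a b) scale_fun"
  unfolding scale_quot_def using phi_continuous psi_continuous psi_pos
  by (intro continuous_intros) force+

text \<open>Near a, \<open>\<phi>\<close> is below t and \<open>\<psi>\<close> above 1; near b it is
  the other way round. So the quotient takes values on both sides of t.\<close>

lemma scale_image: "scale_fun ` einterval a b = {0<..}"
proof (intro equalityI subsetI)
  fix t :: real assume "t \<in> {0<..}"
  then have t: "0 < t" by simp
  have "\<forall>\<^sub>F e in at_right a. \<phi> (real_of_ereal e) < t" "\<forall>\<^sub>F e in at_right a. 1 < \<psi> (real_of_ereal e)"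
    using order_tendstoD(2)[OF phi_left t] psi_left by (auto simp: filterlim_at_top_dense)
  then have "\<forall>\<^sub>F e in at_right a. \<phi> (real_of_ereal e) < t \<and> 1 < \<psi> (real_of_ereal e)"
    by (rule eventually_conj)
  then obtain u where u: "u \<in> einterval a b" "\<phi> u < t \<and> 1 < \<psi> u"
    using eventually_at_right_einterval[OF a_less_b, of "\<lambda>u. \<phi> u < t \<and> 1 < \<psi> u"] by blast
  have "\<forall>\<^sub>F e in at_left b. t < \<phi> (real_of_ereal e)" "\<forall>\<^sub>F e in at_left b. \<psi> (real_of_ereal e) < 1"
    using order_tendstoD(2)[OF psi_right zero_less_one] phi_right by (auto simp: filterlim_at_top_dense)
  then have "\<forall>\<^sub>F e in at_left b. t < \<phi> (real_of_ereal e) \<and> \<psi> (real_of_ereal e) < 1"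
    by (rule eventually_conj)
  then obtain v where v: "v \<in> einterval a b" "t < \<phi> v \<and> \<psi> v < 1"
    using eventually_at_left_einterval[OF a_less_b, of "\<lambda>v. t < \<phi> v \<and> \<psi> v < 1"] by blast
  have "t * 1 < t * \<psi> u" using u t by (intro mult_strict_left_mono) auto
  then have "scale_fun u < t" using u psi_pos[OF u(1)] by (simp add: scale_quot_def divide_simps)
  have "t * \<psi> v < t * 1" using v t by (intro mult_strict_left_mono) auto
  then have "t < scale_fun v" using v psi_pos[OF v(1)] by (simp add: scale_quot_def divide_simps)
  have "u \<le> v" using \<open>scale_fun u < t\<close> \<open>t < scale_fun v\<close> scale_le_iff[OF u(1) v(1)] by simp
  have sub: "{u..v} \<subseteq> einterval a b" using u(1) v(1) by (rule Icc_subset_einterval)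
  obtain x where "u \<le> x" "x \<le> v" "scale_fun x = t"
    using IVT'[of scale_fun u t v] \<open>scale_fun u < t\<close> \<open>t < scale_fun v\<close> \<open>u \<le> v\<close>
      continuous_on_subset[OF continuous_on_scale sub] by auto
  then show "t \<in> scale_fun ` einterval a b" using sub by (intro image_eqI[of _ _ x]) auto
qed (auto simp: scale_pos)

definition unscale :: "real \<Rightarrow> real" where
  "unscale = the_inv_into (einterval a b) scale_fun"

lemma unscale_scale [simp]: "x \<in> einterval a b \<Longrightarrow> unscale (scale_fun x) = x"
  unfolding unscale_def by (rule the_inv_into_f_f[OF inj_on_scale])

lemma
  assumes "0 < t"
  shows unscale_in: "unscale t \<in> einterval a b" and scale_unscale: "scale_fun (unscale t) = t"
proof -
  have "t \<in> scale_fun ` einterval a b" using assms scale_image by simp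
  then show "unscale t \<in> einterval a b" "scale_fun (unscale t) = t" by auto
qed

lemma unscale_image: "unscale ` {0<..} = einterval a b"
  using unscale_in unscale_scale scale_pos by force

text \<open>A monotone function with open image has no jumps.\<close>

lemma continuous_on_unscale: "continuous_on {0<..} unscale"
proof (rule continuous_onI_mono)
  show "unscale t \<le> unscale t'" if "t \<in> {0<..}" "t' \<in> {0<..}" "t \<le> t'" for t t'
    using that scale_le_iff[of "unscale t" "unscale t'"] by (simp add: unscale_in scale_unscale)
qed (simp add: unscale_image)

lemma transformed_eq: "transformed (einterval a b) \<phi> \<psi> f t = f (unscale t) / \<psi> (unscale t)"
  by (simp add: transformed_def unscale_def)

lemma transformed_scale:
  "x \<in> einterval a b \<Longrightarrow> transformed (einterval a b) \<phi> \<psi> f (scale_fun x) = f x / \<psi> x"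
  by (simp add: transformed_eq)

lemma continuous_on_transformed:
  assumes "continuous_on (einterval a b) f"
  shows "continuous_on {0<..} (transformed (einterval a b) \<phi> \<psi> f)"
proof -
  have "continuous_on (einterval a b) (\<lambda>x. f x / \<psi> x)"
    using assms psi_continuous psi_pos by (intro continuous_intros) force+
  then have "continuous_on {0<..} (\<lambda>t. f (unscale t) / \<psi> (unscale t))"
    by (rule continuous_on_compose2[OF _ continuous_on_unscale]) (simp add: unscale_image)
  then show ?thesis by (simp add: transformed_eq[abs_def])
qed

section \<open>Boundary gaps in the natural scale and the identity for the infimum\<close>

context
  fixes G H :: "real \<Rightarrow> real"
  assumes cont: "continuous_on (einterval a b) G" "continuous_on (einterval a b) H"
    and le: "\<And>x. x \<in> einterval a b \<Longrightarrow> G x \<le> H x"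
    and fin: "\<And>x. x \<in> einterval a b \<Longrightarrow>
        (\<integral>\<^sup>+\<omega>. (SUP t\<in>{0..}. ennreal \<bar>exp (- r * t) * G (real_of_ereal (X t \<omega>))\<bar>) \<partial>P x) < \<infinity>"
      "\<And>x. x \<in> einterval a b \<Longrightarrow>
        (\<integral>\<^sup>+\<omega>. (SUP t\<in>{0..}. ennreal \<bar>exp (- r * t) * H (real_of_ereal (X t \<omega>))\<bar>) \<partial>P x) < \<infinity>"
    and lim: "\<And>x. x \<in> einterval a b \<Longrightarrow> AE \<omega> in P x. \<exists>l.
        ((\<lambda>t. exp (- r * t) * G (real_of_ereal (X t \<omega>))) \<longlongrightarrow> l) at_top \<and>
        ((\<lambda>t. exp (- r * t) * H (real_of_ereal (X t \<omega>))) \<longlongrightarrow> l) at_top"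
begin

abbreviation "WG \<equiv> transformed (einterval a b) \<phi> \<psi> G"
abbreviation "WH \<equiv> transformed (einterval a b) \<phi> \<psi> H"

text \<open>For y below a fixed starting point x, \<open>(H y - G y)\<close> times the expected
  discount until y is hit equals the gap at \<open>scale_fun y\<close> times
  \<open>\<psi> x\<close>. Points with a gap of at least \<epsilon> that tend to 0 would contradict
  the convergence of this product to 0.\<close>

lemma transformed_gap_at_0:
  assumes "0 < \<epsilon>"
  shows "\<exists>\<delta>>0. \<forall>t. 0 < t \<and> t < \<delta> \<longrightarrow> WH t - WG t < \<epsilon>"
proof (rule ccontr)
  assume neg: "\<not> ?thesis"
  have "\<exists>t. 0 < t \<and> t < inverse (real (Suc n)) \<and> \<epsilon> \<le> WH t - WG t" for n
    using neg by (metis inverse_positive_iff_positive of_nat_0_less_iff zero_less_Suc not_less)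
  then obtain t where t: "\<And>n. 0 < t n" "\<And>n. t n < inverse (real (Suc n))" "\<And>n. \<epsilon> \<le> WH (t n) - WG (t n)"
    by metis
  define y where "y n = unscale (t n)" for n
  have y: "y n \<in> einterval a b" "scale_fun (y n) = t n" for n
    using t(1) by (simp_all add: y_def unscale_in scale_unscale)
  have "t \<longlonglongrightarrow> 0"
  proof (rule tendsto_sandwich[OF _ _ tendsto_const LIMSEQ_inverse_real_of_nat])
    show "\<forall>\<^sub>F n in sequentially. 0 \<le> t n" using t(1) by (simp add: less_imp_le)
    show "\<forall>\<^sub>F n in sequentially. t n \<le> inverse (real (Suc n))" using t(2) by (simp add: less_imp_le)
  qed
  then have left: "\<forall>\<^sub>F n in sequentially. y n < c" if "c \<in> einterval a b" for c
    using order_tendstoD(2)[of t 0 sequentially "scale_fun c"] scale_pos[OF that] scale_less_iff[OF y(1) that] y(2)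
    by (auto elim!: eventually_mono)
  obtain x where x: "x \<in> einterval a b" using einterval_nonempty[OF a_less_b] by blast
  have "(\<lambda>n. (H (y n) - G (y n)) * (\<integral>\<omega>. discount_at r (hitting_time X (ereal (y n)) \<omega>) \<partial>P x)) \<longlonglongrightarrow> 0"
  proof (rule discounted_gap_tendsto_0[OF x y(1) cont fin(1)[OF x] fin(2)[OF x] lim[OF x]])
    fix c d assume "c \<in> einterval a b"
    show "\<forall>\<^sub>F n in sequentially. y n \<notin> {c..d}"
      using left[OF \<open>c \<in> einterval a b\<close>] by eventually_elim auto
  qed
  then have "\<forall>\<^sub>F n in sequentially. (H (y n) - G (y n)) *
      (\<integral>\<omega>. discount_at r (hitting_time X (ereal (y n)) \<omega>) \<partial>P x) < \<epsilon> * \<psi> x"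
    using psi_pos[OF x] \<open>0 < \<epsilon>\<close> by (intro order_tendstoD(2)) auto
  then have "\<forall>\<^sub>F n::nat in sequentially. False"
    using left[OF x]
  proof eventually_elim
    case (elim n)
    have "(H (y n) - G (y n)) / \<psi> (y n) * \<psi> x < \<epsilon> * \<psi> x"
      using elim hit_below[OF x y(1)[of n]] by simp
    then have "(H (y n) - G (y n)) / \<psi> (y n) < \<epsilon>"
      using psi_pos[OF x] by (rule mult_right_less_imp_less[OF _ less_imp_le])
    then show False using t(3)[of n] by (simp add: transformed_eq y_def diff_divide_distrib)
  qed
  then show False by simp
qed

text \<open>For y above x the hitting formula divides by \<open>\<phi> y\<close>, which is
  \<open>\<psi> y\<close> times the scale; this is why the gap is compared with t here.\<close>

lemma transformed_gap_at_infinity: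
  assumes "0 < \<epsilon>"
  shows "\<exists>N. \<forall>t>N. WH t - WG t < \<epsilon> * t"
proof (rule ccontr)
  assume neg: "\<not> ?thesis"
  have "\<exists>t. real n < t \<and> \<epsilon> * t \<le> WH t - WG t" for n
    using neg by (metis not_less)
  then obtain t where t: "\<And>n. real n < t n" "\<And>n. \<epsilon> * t n \<le> WH (t n) - WG (t n)"
    by metis
  define y where "y n = unscale (t n)" for n
  have y: "y n \<in> einterval a b" "scale_fun (y n) = t n" for n
    using le_less_trans[OF of_nat_0_le_iff t(1)] by (simp_all add: y_def unscale_in scale_unscale)
  have "filterlim t at_top sequentially"
    by (rule filterlim_at_top_mono[OF filterlim_real_sequentially]) (simp add: less_imp_le t(1))
  then have right: "\<forall>\<^sub>F n in sequentially. c < y n" if "c \<in> einterval a b" for c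
    using scale_less_iff[OF that y(1)] y(2)
    by (auto simp: filterlim_at_top_dense elim!: allE[of _ "scale_fun c"] eventually_mono)
  obtain x where x: "x \<in> einterval a b" using einterval_nonempty[OF a_less_b] by blast
  have "(\<lambda>n. (H (y n) - G (y n)) * (\<integral>\<omega>. discount_at r (hitting_time X (ereal (y n)) \<omega>) \<partial>P x)) \<longlonglongrightarrow> 0"
  proof (rule discounted_gap_tendsto_0[OF x y(1) cont fin(1)[OF x] fin(2)[OF x] lim[OF x]])
    fix c d assume "d \<in> einterval a b"
    show "\<forall>\<^sub>F n in sequentially. y n \<notin> {c..d}"
      using right[OF \<open>d \<in> einterval a b\<close>] by eventually_elim auto
  qed
  then have "\<forall>\<^sub>F n in sequentially. (H (y n) - G (y n)) *
      (\<integral>\<omega>. discount_at r (hitting_time X (ereal (y n)) \<omega>) \<partial>P x) < \<epsilon> * \<phi> x"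
    using phi_pos[OF x] \<open>0 < \<epsilon>\<close> by (intro order_tendstoD(2)) auto
  then have "\<forall>\<^sub>F n::nat in sequentially. False"
    using right[OF x]
  proof eventually_elim
    case (elim n)
    have pos: "0 < \<phi> (y n)" "0 < \<psi> (y n)" using phi_pos psi_pos y(1) by auto
    have "(H (y n) - G (y n)) / \<phi> (y n) * \<phi> x < \<epsilon> * \<phi> x"
      using elim hit_above[OF x y(1)[of n]] by simp
    then have "(H (y n) - G (y n)) / \<phi> (y n) < \<epsilon>"
      using phi_pos[OF x] by (rule mult_right_less_imp_less[OF _ less_imp_le])
    then have "(H (y n) - G (y n)) / \<psi> (y n) < \<epsilon> * (\<phi> (y n) / \<psi> (y n))"
      using pos by (simp add: divide_simps)
    moreover have "\<phi> (y n) / \<psi> (y n) = t n" using y(2)[of n] by (simp add: scale_quot_def)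
    ultimately have "(H (y n) - G (y n)) / \<psi> (y n) < \<epsilon> * t n" by (simp only:)
    then show False using t(2)[of n] by (simp add: transformed_eq y_def diff_divide_distrib)
  qed
  then show False by simp
qed

lemma continuous_on_WG: "continuous_on {0<..} WG" and continuous_on_WH: "continuous_on {0<..} WH"
  using cont by (auto intro: continuous_on_transformed)

lemma WG_le_WH: "0 < t \<Longrightarrow> WG t \<le> WH t"
  using le psi_pos unscale_in by (simp add: transformed_eq divide_right_mono less_imp_le)

lemma chord_envelope_superharmonic:
  "(\<lambda>x. chord_envelope {0<..} WG WH (scale_fun x) * \<psi> x) \<in> superharmonic_class (einterval a b) \<phi> \<psi> G H"
proof -
  let ?V = "chord_envelope {0<..} WG WH"
  have D: "open {0::real<..}" "\<And>t. t \<in> {0<..} \<Longrightarrow> WG t \<le> WH t"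
    using WG_le_WH by auto
  note tube = D(1) continuous_on_WG continuous_on_WH D(2)
  have between: "G x \<le> ?V (scale_fun x) * \<psi> x" "?V (scale_fun x) * \<psi> x \<le> H x" if "x \<in> einterval a b" for x
    using chord_envelope_between[OF tube, of "scale_fun x"] scale_pos[OF that] psi_pos[OF that]
    by (simp_all add: transformed_scale[OF that] divide_simps)
  have "continuous_on (einterval a b) (\<lambda>x. ?V (scale_fun x) * \<psi> x)"
    by (intro continuous_on_mult psi_continuous
        continuous_on_compose2[OF continuous_on_chord_envelope[OF tube] continuous_on_scale])
      (auto simp: scale_pos)
  moreover have "r_superharmonic_on \<phi> \<psi> {x \<in> einterval a b. ?V (scale_fun x) * \<psi> x < H x} (\<lambda>x. ?V (scale_fun x) * \<psi> x)"
    unfolding r_superharmonic_on_def Let_def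
  proof (intro allI impI, elim conjE)
    fix x y z assume yxz: "y \<le> x" "x \<le> z" "y < z"
      and sub: "{y..z} \<subseteq> {x \<in> einterval a b. ?V (scale_fun x) * \<psi> x < H x}"
    have I: "x \<in> einterval a b" "y \<in> einterval a b" "z \<in> einterval a b"
      using yxz subsetD[OF sub, of x] subsetD[OF sub, of y] subsetD[OF sub, of z] by simp_all
    have "?V (scale_fun y) * ((scale_fun z - scale_fun x) / (scale_fun z - scale_fun y)) + ?V (scale_fun z) * ((scale_fun x - scale_fun y) / (scale_fun z - scale_fun y))
        \<le> ?V (scale_fun x)"
    proof (rule chord_envelope_concave[OF tube])
      show "scale_fun y \<le> scale_fun x" "scale_fun x \<le> scale_fun z" "scale_fun y < scale_fun z"
        using yxz I by (simp_all add: scale_le_iff scale_less_iff)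
      show "{scale_fun y..scale_fun z} \<subseteq> {0<..}" using scale_pos[OF I(2)] by auto
      fix \<tau> assume \<tau>: "scale_fun y \<le> \<tau>" "\<tau> \<le> scale_fun z"
      then have "0 < \<tau>" using scale_pos[OF I(2)] by simp
      define w where "w = unscale \<tau>"
      have w: "w \<in> einterval a b" "scale_fun w = \<tau>"
        using \<open>0 < \<tau>\<close> by (simp_all add: w_def unscale_in scale_unscale)
      then have "w \<in> {y..z}" using \<tau> I scale_le_iff[OF I(2) w(1)] scale_le_iff[OF w(1) I(3)] by simp
      then have "?V (scale_fun w) * \<psi> w < H w" using sub by blast
      then show "?V \<tau> < WH \<tau>"
        using psi_pos[OF w(1)] transformed_scale[OF w(1), of H] w(2) by (simp add: pos_less_divide_eq)
    qed
    then show "?V (scale_fun y) * \<psi> y / \<psi> y * ((scale_fun z - scale_fun x) / (scale_fun z - scale_fun y))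
        + ?V (scale_fun z) * \<psi> z / \<psi> z * ((scale_fun x - scale_fun y) / (scale_fun z - scale_fun y)) \<le> ?V (scale_fun x) * \<psi> x / \<psi> x"
      using psi_pos[OF I(1)] psi_pos[OF I(2)] psi_pos[OF I(3)] by simp
  qed
  ultimately show ?thesis using between by (simp add: superharmonic_class_def)
qed

text \<open>Concavity of \<open>U / \<psi>\<close> with respect to the scale is ordinary concavity
  of the transformed function, so the planar comparison applies with the two boundary gap
  estimates.\<close>

lemma biconj_lower_le_superharmonic:
  assumes "U \<in> superharmonic_class (einterval a b) \<phi> \<psi> G H" and x: "x \<in> einterval a b"
  shows "biconj_lower WG WH (scale_fun x) \<le> ereal (U x / \<psi> x)"
  unfolding biconj_lower_def
proof (intro SUP_least)
  fix c y assume y: "y \<in> lower_admissible WG WH (scale_fun x) c"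
  let ?u = "transformed (einterval a b) \<phi> \<psi> U"
  have U: "\<And>x. x \<in> einterval a b \<Longrightarrow> G x \<le> U x" "continuous_on (einterval a b) U"
    "r_superharmonic_on \<phi> \<psi> {x \<in> einterval a b. U x < H x} U"
    using assms(1) by (auto simp: superharmonic_class_def)
  have "c * (scale_fun x - y) + WG y \<le> ?u (scale_fun x)"
  proof (rule lower_admissible_le[OF continuous_on_WG continuous_on_WH WG_le_WH _ _ _
        transformed_gap_at_0 transformed_gap_at_infinity _ y])
    show "0 < scale_fun x" using x by (rule scale_pos)
    show "continuous_on {0<..} ?u" using U(2) by (rule continuous_on_transformed)
    show "WG t \<le> ?u t" if "0 < t" for t
      using that U(1) psi_pos unscale_in by (simp add: transformed_eq divide_right_mono less_imp_le)
    fix s t assume s: "0 < s" "s < scale_fun x" and t: "scale_fun x < t"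
      and below: "\<And>\<tau>. s \<le> \<tau> \<Longrightarrow> \<tau> \<le> t \<Longrightarrow> ?u \<tau> < WH \<tau>"
    define y where "y = unscale s"
    define z where "z = unscale t"
    have y: "y \<in> einterval a b" "scale_fun y = s" using s by (simp_all add: y_def unscale_in scale_unscale)
    have z: "z \<in> einterval a b" "scale_fun z = t"
      using s t by (simp_all add: z_def unscale_in scale_unscale)
    have "y < x" "x < z" using s t scale_less_iff[OF y(1) x] scale_less_iff[OF x z(1)] y(2) z(2) by simp_all
    have "{y..z} \<subseteq> {x \<in> einterval a b. U x < H x}"
    proof
      fix w assume w: "w \<in> {y..z}"
      then have wI: "w \<in> einterval a b" using Icc_subset_einterval[OF y(1) z(1)] by blast
      have "?u (scale_fun w) < WH (scale_fun w)"
        using w scale_le_iff[OF y(1) wI] scale_le_iff[OF wI z(1)] y(2) z(2) by (intro below) auto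
      then show "w \<in> {x \<in> einterval a b. U x < H x}"
        using wI psi_pos[OF wI] by (simp add: transformed_scale divide_less_cancel)
    qed
    then have "U y / \<psi> y * ((scale_fun z - scale_fun x) / (scale_fun z - scale_fun y)) + U z / \<psi> z * ((scale_fun x - scale_fun y) / (scale_fun z - scale_fun y))
        \<le> U x / \<psi> x"
      using U(3) \<open>y < x\<close> \<open>x < z\<close> unfolding r_superharmonic_on_def Let_def
      by (meson less_imp_le less_trans)
    then show "?u s * ((t - scale_fun x) / (t - s)) + ?u t * ((scale_fun x - s) / (t - s)) \<le> ?u (scale_fun x)"
      using transformed_scale[OF x, of U] transformed_scale[OF y(1), of U] transformed_scale[OF z(1), of U]
        y(2) z(2) by simp
  qed
  then show "ereal (c * (scale_fun x - y) + WG y) \<le> ereal (U x / \<psi> x)"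
    by (simp add: transformed_scale[OF x])
qed

text \<open>The rescaled chord envelope lies above the infimum, being admissible, and below the
  biconjugate, which lies below every admissible function. All three therefore coincide.\<close>

lemma biconj_lower_diffusion_eq:
  assumes x: "x \<in> einterval a b"
  shows "biconj_lower_diffusion (einterval a b) \<phi> \<psi> G H x =
    (INF U\<in>superharmonic_class (einterval a b) \<phi> \<psi> G H. ereal (U x))"
proof (rule antisym)
  have \<psi>: "0 < \<psi> x" using x by (rule psi_pos)
  show "biconj_lower_diffusion (einterval a b) \<phi> \<psi> G H x \<le>
      (INF U\<in>superharmonic_class (einterval a b) \<phi> \<psi> G H. ereal (U x))"
  proof (rule INF_greatest)
    fix U assume "U \<in> superharmonic_class (einterval a b) \<phi> \<psi> G H"
    from ereal_mult_right_mono[OF biconj_lower_le_superharmonic[OF this x], of "ereal (\<psi> x)"]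
    show "biconj_lower_diffusion (einterval a b) \<phi> \<psi> G H x \<le> ereal (U x)"
      using \<psi> by (simp add: biconj_lower_diffusion_def)
  qed
  have "(INF U\<in>superharmonic_class (einterval a b) \<phi> \<psi> G H. ereal (U x))
      \<le> ereal (chord_envelope {0<..} WG WH (scale_fun x) * \<psi> x)"
    by (rule INF_lower2[OF chord_envelope_superharmonic]) simp
  also have "\<dots> = ereal (chord_envelope {0<..} WG WH (scale_fun x)) * ereal (\<psi> x)" by simp
  also have "\<dots> \<le> biconj_lower WG WH (scale_fun x) * ereal (\<psi> x)"
    using \<psi> scale_pos[OF x] chord_envelope_le_biconj_lower[OF continuous_on_WG continuous_on_WH WG_le_WH]
    by (intro ereal_mult_right_mono) auto
  finally show "(INF U\<in>superharmonic_class (einterval a b) \<phi> \<psi> G H. ereal (U x))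
      \<le> biconj_lower_diffusion (einterval a b) \<phi> \<psi> G H x"
    by (simp add: biconj_lower_diffusion_def)
qed

end

end

section \<open>Passage to the supremum by negation\<close>

lemma left_touch_uminus: "left_touch (\<lambda>t. - f t) x (- c) (- p) = left_touch f x c p"
proof -
  have "{z. 0 < z \<and> z \<le> x \<and> - f z - - p = - c * (z - x)} = {z. 0 < z \<and> z \<le> x \<and> f z - p = c * (z - x)}"
    by (auto simp: algebra_simps)
  then show ?thesis unfolding left_touch_def by simp
qed

lemma right_touch_uminus: "right_touch (\<lambda>t. - f t) x (- c) (- p) = right_touch f x c p"
proof -
  have "{y. x \<le> y \<and> - f y - - p = - c * (y - x)} = {y. x \<le> y \<and> f y - p = c * (y - x)}"
    by (auto simp: algebra_simps)
  then show ?thesis unfolding right_touch_def by simp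
qed

text \<open>Negation exchanges the two obstacles and reverses slope and height of the line, but
  leaves the contact points in place.\<close>

lemma upper_admissible_uminus:
  "upper_admissible g h x c = lower_admissible (\<lambda>t. - h t) (\<lambda>t. - g t) x (- c)"
proof -
  have "{- h x..- g x} = uminus ` {g x..h x}" by simp
  then show ?thesis
    unfolding upper_admissible_def lower_admissible_def
    by (simp only: UN_simps left_touch_uminus right_touch_uminus)
qed

lemma biconj_upper_uminus: "biconj_upper g h x = - biconj_lower (\<lambda>t. - h t) (\<lambda>t. - g t) x"
proof -
  \<comment> \<open>Slopes are reindexed by their negatives to match the reversed slope in the
    admissible sets.\<close>
  have "biconj_lower (\<lambda>t. - h t) (\<lambda>t. - g t) x
      = (SUP z\<in>range uminus. SUP y\<in>lower_admissible (\<lambda>t. - h t) (\<lambda>t. - g t) x z. ereal (z * (x - y) + - h y))"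
    unfolding biconj_lower_def by simp
  also have "\<dots> = (SUP z. SUP y\<in>upper_admissible g h x z. - ereal (z * (x - y) + h y))"
    unfolding image_image upper_admissible_uminus by simp
  also have "\<dots> = - biconj_upper g h x"
    unfolding biconj_upper_def by (simp only: ereal_SUP_uminus_eq)
  finally show ?thesis by simp
qed

lemma subharmonic_class_uminus:
  "subharmonic_class I \<phi> \<psi> G H = (\<lambda>U x. - U x) ` superharmonic_class I \<phi> \<psi> (\<lambda>x. - H x) (\<lambda>x. - G x)"
proof -
  have cont: "continuous_on I (\<lambda>x. - U x) \<longleftrightarrow> continuous_on I U" for U :: "real \<Rightarrow> real"
    using continuous_on_minus[of I U] continuous_on_minus[of I "\<lambda>x. - U x"] by auto
  have sup: "r_superharmonic_on \<phi> \<psi> A (\<lambda>x. - U x) \<longleftrightarrow> r_subharmonic_on \<phi> \<psi> A U" for A U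
  proof -
    have "- U y / p * s + - U z / q * t \<le> - U x / w \<longleftrightarrow> U x / w \<le> U y / p * s + U z / q * t"
      for x y z p q s t w by auto
    then show ?thesis unfolding r_superharmonic_on_def r_subharmonic_on_def Let_def by simp
  qed
  have mem: "(\<lambda>x. - U x) \<in> superharmonic_class I \<phi> \<psi> (\<lambda>x. - H x) (\<lambda>x. - G x) \<longleftrightarrow> U \<in> subharmonic_class I \<phi> \<psi> G H"
    for U unfolding superharmonic_class_def subharmonic_class_def by (auto simp: cont sup)
  show ?thesis
  proof (intro equalityI subsetI)
    fix U assume "U \<in> subharmonic_class I \<phi> \<psi> G H"
    then show "U \<in> (\<lambda>U x. - U x) ` superharmonic_class I \<phi> \<psi> (\<lambda>x. - H x) (\<lambda>x. - G x)"
      by (intro image_eqI[of _ _ "\<lambda>x. - U x"]) (simp_all add: mem)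
  next
    fix U assume "U \<in> (\<lambda>U x. - U x) ` superharmonic_class I \<phi> \<psi> (\<lambda>x. - H x) (\<lambda>x. - G x)"
    then show "U \<in> subharmonic_class I \<phi> \<psi> G H" by (auto simp: mem[symmetric])
  qed
qed

lemma transformed_uminus: "transformed I \<phi> \<psi> (\<lambda>x. - f x) = (\<lambda>t. - transformed I \<phi> \<psi> f t)"
  by (simp add: transformed_def fun_eq_iff)

lemma biconj_upper_diffusion_uminus:
  "biconj_upper_diffusion I \<phi> \<psi> G H x = - biconj_lower_diffusion I \<phi> \<psi> (\<lambda>x. - H x) (\<lambda>x. - G x) x"
  by (simp add: biconj_upper_diffusion_def biconj_lower_diffusion_def biconj_upper_uminus transformed_uminus)

theorem lemma21:
  fixes M :: "'w measure" and F :: "ennreal \<Rightarrow> 'w measure" and a b :: ereal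
    and P :: "real \<Rightarrow> 'w measure" and X :: "real \<Rightarrow> 'w \<Rightarrow> ereal"
    and r :: real and \<phi> \<psi> G H :: "real \<Rightarrow> real"
  defines "I \<equiv> einterval a b"
  assumes "discounted_diffusion M F a b P X r \<phi> \<psi>"
    and "continuous_on I G" and "continuous_on I H"
    and "\<And>x. x \<in> I \<Longrightarrow> G x \<le> H x"
    and "\<And>x. x \<in> I \<Longrightarrow>
      (\<integral>\<^sup>+\<omega>. (SUP t\<in>{0..}. ennreal \<bar>exp (- r * t) * G (real_of_ereal (X t \<omega>))\<bar>) \<partial>P x) < \<infinity>"
    and "\<And>x. x \<in> I \<Longrightarrow>
      (\<integral>\<^sup>+\<omega>. (SUP t\<in>{0..}. ennreal \<bar>exp (- r * t) * H (real_of_ereal (X t \<omega>))\<bar>) \<partial>P x) < \<infinity>"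
    and "\<And>x. x \<in> I \<Longrightarrow> AE \<omega> in P x. \<exists>l.
      ((\<lambda>t. exp (- r * t) * G (real_of_ereal (X t \<omega>))) \<longlongrightarrow> l) at_top \<and>
      ((\<lambda>t. exp (- r * t) * H (real_of_ereal (X t \<omega>))) \<longlongrightarrow> l) at_top"
  shows "\<forall>x\<in>I.
      biconj_lower_diffusion I \<phi> \<psi> G H x = (INF U\<in>superharmonic_class I \<phi> \<psi> G H. ereal (U x)) \<and>
      biconj_upper_diffusion I \<phi> \<psi> G H x = (SUP U\<in>subharmonic_class I \<phi> \<psi> G H. ereal (U x))"
proof (intro ballI conjI)
  interpret discounted_diffusion M F a b P X r \<phi> \<psi> by (rule assms(2))
  note I_def [simp]
  fix x assume x: "x \<in> I"
  show "biconj_lower_diffusion I \<phi> \<psi> G H x = (INF U\<in>superharmonic_class I \<phi> \<psi> G H. ereal (U x))"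
    using assms(3-) x unfolding I_def by (intro biconj_lower_diffusion_eq) auto
  \<comment> \<open>The tube for the second identity is \<open>- H \<le> - G\<close>, so both
    functions are negated, their order is exchanged, and the common limit becomes
    \<open>- l\<close>.\<close>
  have lim: "AE \<omega> in P x. \<exists>l.
      ((\<lambda>t. exp (- r * t) * - H (real_of_ereal (X t \<omega>))) \<longlongrightarrow> l) at_top \<and>
      ((\<lambda>t. exp (- r * t) * - G (real_of_ereal (X t \<omega>))) \<longlongrightarrow> l) at_top" if "x \<in> I" for x
    using assms(8)[OF that]
  proof eventually_elim
    case (elim \<omega>)
    then obtain l where "((\<lambda>t. exp (- r * t) * G (real_of_ereal (X t \<omega>))) \<longlongrightarrow> l) at_top"
      "((\<lambda>t. exp (- r * t) * H (real_of_ereal (X t \<omega>))) \<longlongrightarrow> l) at_top" by blast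
    from this[THEN tendsto_minus] show ?case by (intro exI[of _ "- l"]) simp
  qed
  have "biconj_lower_diffusion I \<phi> \<psi> (\<lambda>x. - H x) (\<lambda>x. - G x) x
      = (INF U\<in>superharmonic_class I \<phi> \<psi> (\<lambda>x. - H x) (\<lambda>x. - G x). ereal (U x))"
    unfolding I_def
    using assms(3-7) lim x
    by (intro biconj_lower_diffusion_eq) (auto intro: continuous_on_minus simp: abs_mult)
  then show "biconj_upper_diffusion I \<phi> \<psi> G H x = (SUP U\<in>subharmonic_class I \<phi> \<psi> G H. ereal (U x))"
    unfolding biconj_upper_diffusion_uminus subharmonic_class_uminus image_image
    by (simp add: ereal_SUP_uminus_eq flip: uminus_ereal.simps)
qed

end
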